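(* Let $(X,\mathscr{A},\mu)$ be a $\sigma$-finite measure space, $\phi$ an $\mathscr{A}$-measurable transformation of $X$, $(T,\Sigma)$ a measurable space and $P\colon X\times\Sigma\to[0,1]$ an $\mathscr{A}$-measurable family of probability measures. Let $\rho$ be the unique measure on $\mathscr{A}\otimes\Sigma$ with $\rho(\Delta\times\sigma)=\int_\Delta P(x,\sigma)\,\mu(\mathrm{d}x)$ for $\Delta\in\mathscr{A}$, $\sigma\in\Sigma$, and let $\Phi(x,t)=(\phi(x),t)$. Let $\zeta\colon T\to[0,\infty]$ be $\Sigma$-measurable, and assume $\phi$ is nonsingular and $\mathsf{h}_\phi<\infty$ a.e. $[\mu]$. Consider (CC$_\zeta$): $\mathsf{E}(P(\cdot,\sigma))(x)=\dfrac{\int_\sigma\zeta(t)P(\phi(x),\mathrm{d}t)}{\mathsf{h}_\phi(\phi(x))}$ for $\mu$-a.e. $x\in X$, for every $\sigma\in\Sigma$. Then the following are equivalent: (i) (CC$_\zeta$) holds and $\mathsf{h}_\phi>0$ a.e. $[\mu]$; (ii) (CC$_\zeta$) holds and $\int_T\zeta(t)P(\cdot,\mathrm{d}t)=0$ a.e. $[\mu]$ on $\{\mathsf{h}_\phi=0\}$; (iii) (CC$_\zeta$) holds, $\Phi$ is nonsingular and $C_\Phi$ (in $L^2(\rho)$) is quasinormal; (iv) $\mathsf{h}_\phi(x)\big(\mathsf{E}(P(\cdot,\sigma))\circ\phi^{-1}\big)(x)=\int_\sigma\zeta(t)P(x,\mathrm{d}t)$ for $\mu$-a.e. $x\in X$,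 for every $\sigma\in\Sigma$; (v) $\Phi$ is nonsingular and $\mathsf{h}_\Phi(x,t)=\zeta(t)$ for $\rho$-a.e. $(x,t)\in X\times T$; (vi) $\Phi$ is nonsingular, $\mathsf{h}_\phi>0$ a.e. $[\mu]$, and $\int_\sigma\mathsf{h}_\Phi(\phi(x),t)P(\phi(x),\mathrm{d}t)=\int_\sigma\zeta(t)P(\phi(x),\mathrm{d}t)$ for $\mu$-a.e. $x\in X$, for every $\sigma\in\Sigma$. Moreover, each of the conditions (i)–(vi) uniquely determines $\zeta$ (up to sets of $\rho$-measure zero) and guarantees that $0<\zeta<\infty$ a.e. $[\rho]$.
   Context: Conventions: $0\cdot\infty=\infty\cdot0=0$, $1/0=\infty$, $0/0=1$. $\phi$ is $\mathscr{A}$-measurable if $\phi^{-1}(\Delta)\in\mathscr{A}$ for all $\Delta\in\mathscr{A}$; it is nonsingular if moreover $\mu(\phi^{-1}(\Delta))=0$ whenever $\mu(\Delta)=0$. $\mathscr{A}\otimes\Sigma$ is the $\sigma$-algebra generated by measurable rectangles. For a nonsingular transformation $\psi$ of a $\sigma$-finite measure space $(Y,\mathscr{B},\nu)$, $\mathsf{h}_\psi$ is the Radon–Nikodym derivative of $\nu\circ\psi^{-1}$ with respect to $\nu$, and $C_\psi$ is the composition operator in $L^2(\nu)$: $\mathcal{D}(C_\psi)=\{f\in L^2(\nu):f\circ\psi\in L^2(\nu)\}$, $C_\psi f=f\circ\psi$. Since $\mathsf{h}_\phi<\infty$ a.e., $\mu|_{\phi^{-1}(\mathscr{A})}$ is $\sigma$-finite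 and for $\mathscr{A}$-measurable $f\colon X\to[0,\infty]$ the conditional expectation $\mathsf{E}(f)$ is the a.e. unique $\phi^{-1}(\mathscr{A})$-measurable function with $\int (g\circ\phi)f\,\mathrm{d}\mu=\int(g\circ\phi)\mathsf{E}(f)\,\mathrm{d}\mu$ for all $\mathscr{A}$-measurable $g\ge0$; $\mathsf{E}(f)\circ\phi^{-1}$ is the a.e. unique $\mathscr{A}$-measurable $g\colon X\to[0,\infty]$ with $g=0$ a.e. on $\{\mathsf{h}_\phi=0\}$ and $\mathsf{E}(f)=g\circ\phi$ a.e. An $\mathscr{A}$-measurable family of probability measures: $P(x,\cdot)$ is a probability measure for each $x$ and $P(\cdot,\sigma)$ is $\mathscr{A}$-measurable for each $\sigma$. A closed densely defined operator $A=U|A|$ (polar decomposition) is quasinormal if $U|A|\subseteq|A|U$. *)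

theory Defs
  imports "HOL-Probability.Probability"
begin

definition nonsingular :: "'a measure \<Rightarrow> ('a \<Rightarrow> 'a) \<Rightarrow> bool" where
  "nonsingular M f \<longleftrightarrow> f \<in> measurable M M \<and>
     (\<forall>D\<in>sets M. emeasure M D = 0 \<longrightarrow> emeasure M (f -` D \<inter> space M) = 0)"

definition hRN :: "'a measure \<Rightarrow> ('a \<Rightarrow> 'a) \<Rightarrow> 'a \<Rightarrow> ennreal" where
  "hRN M f = RN_deriv M (distr M M f)"

definition condE :: "'a measure \<Rightarrow> ('a \<Rightarrow> 'a) \<Rightarrow> ('a \<Rightarrow> ennreal) \<Rightarrow> 'a \<Rightarrow> ennreal" where
  "condE M f g = nn_cond_exp M (vimage_algebra (space M) f M) g"

text \<open>E(g) o f^{-1}: the a.e. unique measurable function vanishing a.e. on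
  {h_f = 0} whose composition with f equals E(g) a.e.\<close>
definition condE_inv :: "'a measure \<Rightarrow> ('a \<Rightarrow> 'a) \<Rightarrow> ('a \<Rightarrow> ennreal) \<Rightarrow> 'a \<Rightarrow> ennreal" where
  "condE_inv M f g = (SOME u. u \<in> borel_measurable M \<and>
       (AE x in M. hRN M f x = 0 \<longrightarrow> u x = 0) \<and>
       (AE x in M. condE M f g x = u (f x)))"

text \<open>Division on [0,\<infinity>] with the conventions 0*\<infinity>=0, 1/0=\<infinity>, 0/0=1.\<close>
definition pdiv :: "ennreal \<Rightarrow> ennreal \<Rightarrow> ennreal" where
  "pdiv a b = (if a = 0 \<and> b = 0 then 1 else a / b)"

definition prob_family :: "'a measure \<Rightarrow> 't measure \<Rightarrow> ('a \<Rightarrow> 't measure) \<Rightarrow> bool" where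
  "prob_family M N P \<longleftrightarrow> (\<forall>x\<in>space M. prob_space (P x) \<and> sets (P x) = sets N) \<and>
     (\<forall>S\<in>sets N. (\<lambda>x. measure (P x) S) \<in> borel_measurable M)"

definition rho :: "'a measure \<Rightarrow> 't measure \<Rightarrow> ('a \<Rightarrow> 't measure) \<Rightarrow> ('a \<times> 't) measure" where
  "rho M N P = (SOME r. sets r = sets (M \<Otimes>\<^sub>M N) \<and>
      (\<forall>D\<in>sets M. \<forall>S\<in>sets N. emeasure r (D \<times> S) = (\<integral>\<^sup>+x\<in>D. emeasure (P x) S \<partial>M)))"

definition PhiMap :: "('a \<Rightarrow> 'a) \<Rightarrow> ('a \<times> 't) \<Rightarrow> ('a \<times> 't)" where
  "PhiMap f = (\<lambda>(x, t). (f x, t))"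

section \<open>Operators in L^2(M) (complex scalars), represented by graphs of representatives\<close>

definition L2 :: "'a measure \<Rightarrow> ('a \<Rightarrow> complex) set" where
  "L2 M = {f. f \<in> borel_measurable M \<and> integrable M (\<lambda>x. (cmod (f x))\<^sup>2)}"

definition l2_inner :: "'a measure \<Rightarrow> ('a \<Rightarrow> complex) \<Rightarrow> ('a \<Rightarrow> complex) \<Rightarrow> complex" where
  "l2_inner M f g = (LINT x|M. f x * cnj (g x))"

definition l2_norm :: "'a measure \<Rightarrow> ('a \<Rightarrow> complex) \<Rightarrow> real" where
  "l2_norm M f = sqrt (LINT x|M. (cmod (f x))\<^sup>2)"

type_synonym 'a l2op = "(('a \<Rightarrow> complex) \<times> ('a \<Rightarrow> complex)) set"

text \<open>A linear operator in L^2(M), given by its graph; the graph is closed under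
  a.e.-modification of representatives and is single-valued modulo a.e. equality.\<close>
definition l2_operator :: "'a measure \<Rightarrow> 'a l2op \<Rightarrow> bool" where
  "l2_operator M A \<longleftrightarrow> A \<subseteq> L2 M \<times> L2 M \<and>
     ((\<lambda>_. 0), (\<lambda>_. 0)) \<in> A \<and>
     (\<forall>(f, g)\<in>A. \<forall>(f', g')\<in>A. \<forall>c. ((\<lambda>x. c * f x + f' x), (\<lambda>x. c * g x + g' x)) \<in> A) \<and>
     (\<forall>(f, g)\<in>A. \<forall>f' g'. f' \<in> L2 M \<and> g' \<in> L2 M \<and> (AE x in M. f x = f' x) \<and>
         (AE x in M. g x = g' x) \<longrightarrow> (f', g') \<in> A) \<and>
     (\<forall>(f, g)\<in>A. \<forall>(f', g')\<in>A. (AE x in M. f x = f' x) \<longrightarrow> (AE x in M. g x = g' x))"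

definition op_dom :: "'a l2op \<Rightarrow> ('a \<Rightarrow> complex) set" where
  "op_dom A = fst ` A"

definition op_ker :: "'a l2op \<Rightarrow> ('a \<Rightarrow> complex) set" where
  "op_ker A = {f. (f, (\<lambda>_. 0)) \<in> A}"

definition op_comp :: "'a l2op \<Rightarrow> 'a l2op \<Rightarrow> 'a l2op" where
  "op_comp B A = {(f, h). \<exists>g. (f, g) \<in> A \<and> (g, h) \<in> B}"

definition op_adjoint :: "'a measure \<Rightarrow> 'a l2op \<Rightarrow> 'a l2op" where
  "op_adjoint M A = {(g, h). g \<in> L2 M \<and> h \<in> L2 M \<and>
      (\<forall>(f, k)\<in>A. l2_inner M k g = l2_inner M f h)}"

definition densely_defined :: "'a measure \<Rightarrow> 'a l2op \<Rightarrow> bool" where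
  "densely_defined M A \<longleftrightarrow>
     (\<forall>h\<in>L2 M. \<forall>e>0. \<exists>f\<in>op_dom A. l2_norm M (\<lambda>x. f x - h x) < e)"

definition closed_op :: "'a measure \<Rightarrow> 'a l2op \<Rightarrow> bool" where
  "closed_op M A \<longleftrightarrow>
     (\<forall>F G f g. (\<forall>n::nat. (F n, G n) \<in> A) \<and> f \<in> L2 M \<and> g \<in> L2 M \<and>
        (\<lambda>n. l2_norm M (\<lambda>x. F n x - f x)) \<longlonglongrightarrow> 0 \<and>
        (\<lambda>n. l2_norm M (\<lambda>x. G n x - g x)) \<longlonglongrightarrow> 0 \<longrightarrow> (f, g) \<in> A)"

definition selfadjoint_op :: "'a measure \<Rightarrow> 'a l2op \<Rightarrow> bool" where
  "selfadjoint_op M A \<longleftrightarrow> l2_operator M A \<and> densely_defined M A \<and> op_adjoint M A = A"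

definition positive_op :: "'a measure \<Rightarrow> 'a l2op \<Rightarrow> bool" where
  "positive_op M A \<longleftrightarrow> (\<forall>(f, g)\<in>A. Im (l2_inner M g f) = 0 \<and> Re (l2_inner M g f) \<ge> 0)"

definition partial_isometry :: "'a measure \<Rightarrow> 'a l2op \<Rightarrow> bool" where
  "partial_isometry M U \<longleftrightarrow> l2_operator M U \<and> op_dom U = L2 M \<and>
     (\<forall>(f, g)\<in>U. (\<forall>k\<in>op_ker U. l2_inner M f k = 0) \<longrightarrow> l2_norm M g = l2_norm M f)"

text \<open>(U, B) is the polar decomposition of A: A = U B, B positive selfadjoint,
  U partial isometry with N(U) = N(B) (it is unique, and B = |A|).\<close>
definition polar_decomposition :: "'a measure \<Rightarrow> 'a l2op \<Rightarrow> 'a l2op \<Rightarrow> 'a l2op \<Rightarrow> bool" where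
  "polar_decomposition M A U B \<longleftrightarrow> partial_isometry M U \<and> selfadjoint_op M B \<and>
     positive_op M B \<and> op_ker U = op_ker B \<and> A = op_comp U B"

definition quasinormal :: "'a measure \<Rightarrow> 'a l2op \<Rightarrow> bool" where
  "quasinormal M A \<longleftrightarrow> l2_operator M A \<and> closed_op M A \<and> densely_defined M A \<and>
     (\<exists>U B. polar_decomposition M A U B \<and> op_comp U B \<subseteq> op_comp B U)"

definition comp_op :: "'a measure \<Rightarrow> ('a \<Rightarrow> 'a) \<Rightarrow> 'a l2op" where
  "comp_op M f = {(u, v). u \<in> L2 M \<and> v \<in> L2 M \<and> (AE x in M. v x = u (f x))}"

definition CC :: "'a measure \<Rightarrow> 't measure \<Rightarrow> ('a \<Rightarrow> 't measure) \<Rightarrow> ('a \<Rightarrow> 'a) \<Rightarrow> ('t \<Rightarrow> ennreal) \<Rightarrow> bool" where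
  "CC M N P f z \<longleftrightarrow> (\<forall>S\<in>sets N. AE x in M.
     condE M f (\<lambda>y. emeasure (P y) S) x = pdiv (\<integral>\<^sup>+t\<in>S. z t \<partial>P (f x)) (hRN M f (f x)))"

definition cond_i where
  "cond_i M N P f z \<longleftrightarrow> CC M N P f z \<and> (AE x in M. hRN M f x > 0)"

definition cond_ii where
  "cond_ii M N P f z \<longleftrightarrow> CC M N P f z \<and>
     (AE x in M. hRN M f x = 0 \<longrightarrow> (\<integral>\<^sup>+t. z t \<partial>P x) = 0)"

definition cond_iii where
  "cond_iii M N P f z \<longleftrightarrow> CC M N P f z \<and> nonsingular (rho M N P) (PhiMap f) \<and>
     quasinormal (rho M N P) (comp_op (rho M N P) (PhiMap f))"

definition cond_iv where
  "cond_iv M N P f z \<longleftrightarrow> (\<forall>S\<in>sets N. AE x in M.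
     hRN M f x * condE_inv M f (\<lambda>y. emeasure (P y) S) x = (\<integral>\<^sup>+t\<in>S. z t \<partial>P x))"

definition cond_v where
  "cond_v M N P f z \<longleftrightarrow> nonsingular (rho M N P) (PhiMap f) \<and>
     (AE p in rho M N P. hRN (rho M N P) (PhiMap f) p = z (snd p))"

definition cond_vi where
  "cond_vi M N P f z \<longleftrightarrow> nonsingular (rho M N P) (PhiMap f) \<and> (AE x in M. hRN M f x > 0) \<and>
     (\<forall>S\<in>sets N. AE x in M.
        (\<integral>\<^sup>+t\<in>S. hRN (rho M N P) (PhiMap f) (f x, t) \<partial>P (f x)) = (\<integral>\<^sup>+t\<in>S. z t \<partial>P (f x)))"

end

theory Submission
  imports Defs
begin

text \<open>Let \<open>W S\<close> be the density of the image under \<open>f\<close> of the measure with density \<open>P x S\<close>.  Then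
  \<open>\<rho>(\<Phi>\<^sup>-\<^sup>1(D \<times> S))\<close> is the integral of \<open>W S\<close> over \<open>D\<close>, and the conditional expectation of
  \<open>P x S\<close> is \<open>(W S / h) \<circ> f\<close>.  Hence both (iv) and (v) say that \<open>W S x = \<integral>\<^sub>S z dP x\<close> almost
  everywhere, while (CC) says the same only where \<open>h > 0\<close>.  Under (v), \<open>\<Phi>\<close> preserves the second
  coordinate, so \<open>z\<close> cannot vanish on a set of positive measure, and then neither can \<open>h\<close>.
  If \<open>C\<close> denotes the composition operator of \<open>\<Phi>\<close>, quasinormality makes the range of \<open>C\<close>
  orthogonal to its kernel; testing this with a strictly positive function forces
  the density of \<open>\<Phi>\<close>, and with it \<open>h\<close>, to be positive.  Conversely, if that density is \<open>z\<close>, it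
  is invariant under \<open>\<Phi>\<close>, and multiplication by its square root commutes with the isometric
  part of \<open>C\<close>.\<close>

subsection \<open>Nonsingular transformations\<close>

lemma nonsingular_measurable: "nonsingular M f \<Longrightarrow> f \<in> measurable M M"
  by (simp add: nonsingular_def)

lemma nonsingular_absolutely_continuous:
  assumes "nonsingular M f"
  shows "absolutely_continuous M (distr M M f)"
  using assms unfolding absolutely_continuous_def nonsingular_def
  by (auto simp: null_sets_def emeasure_distr)

lemma AE_nonsingular:
  assumes "nonsingular M f" "AE x in M. Q x"
  shows "AE x in M. Q (f x)"
proof -
  have "AE x in distr M M f. Q x"
    by (rule absolutely_continuous_AE[OF _ nonsingular_absolutely_continuous[OF assms(1)] assms(2)])
       simp
  then show ?thesis
    by (rule AE_distrD[OF nonsingular_measurable[OF assms(1)]])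
qed

text \<open>A measure with a density with respect to \<open>M\<close> vanishes on the null sets of
  \<open>M\<close>, so a density formula for the image measure already contains
  nonsingularity.\<close>

lemma nonsingular_of_density:
  assumes "f \<in> measurable M M" "g \<in> borel_measurable M" "distr M M f = density M g"
  shows "nonsingular M f"
  unfolding nonsingular_def
proof (intro conjI ballI impI assms)
  fix D assume D: "D \<in> sets M" "emeasure M D = 0"
  have "emeasure (density M g) D = 0"
    using D assms(2) by (intro absolutely_continuousI_density[THEN absolutely_continuousD]) (auto simp: null_sets_def)
  then show "emeasure M (f -` D \<inter> space M) = 0"
    using D assms(1) by (simp add: assms(3)[symmetric] emeasure_distr)
qed

lemma hRN_measurable[measurable]: "hRN M f \<in> borel_measurable M"
  unfolding hRN_def by simp

lemma (in sigma_finite_measure) density_hRN: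
  "nonsingular M f \<Longrightarrow> density M (hRN M f) = distr M M f"
  unfolding hRN_def by (intro density_RN_deriv nonsingular_absolutely_continuous) auto

lemma (in sigma_finite_measure) nn_integral_nonsingular:
  assumes f: "nonsingular M f" and [measurable]: "g \<in> borel_measurable M"
  shows "(\<integral>\<^sup>+x. g (f x) \<partial>M) = (\<integral>\<^sup>+x. hRN M f x * g x \<partial>M)"
proof -
  have "(\<integral>\<^sup>+x. g (f x) \<partial>M) = (\<integral>\<^sup>+x. g x \<partial>distr M M f)"
    using f by (intro nn_integral_distr[symmetric]) (auto simp: nonsingular_def)
  then show ?thesis
    by (simp add: density_hRN[OF f, symmetric] nn_integral_density)
qed

text \<open>The image of \<open>M\<close> under \<open>f\<close> has density \<open>hRN M f\<close>,
  so a property pulled back along \<open>f\<close> is tested only where this density is positive.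
  This is why (CC) carries no information on {h = 0}.\<close>

lemma (in sigma_finite_measure) AE_nonsingular_iff:
  assumes f: "nonsingular M f" and Q: "{x \<in> space M. Q x} \<in> sets M"
  shows "(AE x in M. Q (f x)) \<longleftrightarrow> (AE x in M. 0 < hRN M f x \<longrightarrow> Q x)"
  unfolding AE_distr_iff[OF nonsingular_measurable[OF f] Q, symmetric] density_hRN[OF f, symmetric]
  by (simp add: AE_density)

subsection \<open>Square integrable functions\<close>

lemma op_dom_iff: "u \<in> op_dom A \<longleftrightarrow> (\<exists>v. (u, v) \<in> A)"
  by (force simp: op_dom_def)

lemma L2_iff_nn_integral:
  "u \<in> L2 M \<longleftrightarrow> u \<in> borel_measurable M \<and> (\<integral>\<^sup>+x. ennreal ((cmod (u x))\<^sup>2) \<partial>M) < \<infinity>"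
  unfolding L2_def by (auto simp: integrable_iff_bounded)

lemma L2_measurable: "u \<in> L2 M \<Longrightarrow> u \<in> borel_measurable M"
  by (simp add: L2_def)

lemma L2_integrable: "u \<in> L2 M \<Longrightarrow> integrable M (\<lambda>x. (cmod (u x))\<^sup>2)"
  by (simp add: L2_def)

lemma L2_bound:
  assumes "v \<in> L2 M" "u \<in> borel_measurable M" "AE x in M. cmod (u x) \<le> c * cmod (v x)"
  shows "u \<in> L2 M"
proof -
  have "integrable M (\<lambda>x. c\<^sup>2 * (cmod (v x))\<^sup>2)"
    using assms(1) by (intro integrable_mult_right) (simp add: L2_def)
  moreover have "(\<lambda>x. (cmod (u x))\<^sup>2) \<in> borel_measurable M"
    using assms(2) by measurable
  moreover have "AE x in M. norm ((cmod (u x))\<^sup>2) \<le> norm (c\<^sup>2 * (cmod (v x))\<^sup>2)"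
    using assms(3) by eventually_elim (simp add: power_mult_distrib[symmetric] power_mono)
  ultimately have "integrable M (\<lambda>x. (cmod (u x))\<^sup>2)"
    by (rule Bochner_Integration.integrable_bound)
  with assms(2) show ?thesis by (simp add: L2_def)
qed

lemma norm_add_square_le:
  fixes a b :: "'a::real_normed_vector"
  shows "(norm (a + b))\<^sup>2 \<le> 2 * (norm a)\<^sup>2 + 2 * (norm b)\<^sup>2"
proof -
  have "(norm (a + b))\<^sup>2 \<le> (norm a + norm b)\<^sup>2"
    by (intro power_mono norm_triangle_ineq) simp
  also have "\<dots> \<le> 2 * (norm a)\<^sup>2 + 2 * (norm b)\<^sup>2"
    using sum_squares_bound[of "norm a" "norm b"] by (simp add: power2_sum)
  finally show ?thesis .
qed

lemma L2_scale_add: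
  assumes "u \<in> L2 M" "v \<in> L2 M"
  shows "(\<lambda>x. c * u x + v x) \<in> L2 M"
proof -
  have [measurable]: "u \<in> borel_measurable M" "v \<in> borel_measurable M"
    using assms by (simp_all add: L2_def)
  have "integrable M (\<lambda>x. 2 * ((cmod c)\<^sup>2 * (cmod (u x))\<^sup>2) + 2 * (cmod (v x))\<^sup>2)"
    using assms by (intro Bochner_Integration.integrable_add integrable_mult_right) (simp_all add: L2_def)
  then have "integrable M (\<lambda>x. (cmod (c * u x + v x))\<^sup>2)"
    by (rule Bochner_Integration.integrable_bound)
       (use norm_add_square_le[of "c * u _" "v _"] in
         \<open>auto simp: norm_mult power_mult_distrib intro!: AE_I2\<close>)
  then show ?thesis by (simp add: L2_def)
qed

lemma L2_zero[simp]: "(\<lambda>_. 0) \<in> L2 M"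
  by (simp add: L2_def)

lemma L2_diff: "u \<in> L2 M \<Longrightarrow> v \<in> L2 M \<Longrightarrow> (\<lambda>x. u x - v x) \<in> L2 M"
  using L2_scale_add[of v M u "-1"] by simp

lemma borel_measurable_cnj[measurable]: "cnj \<in> borel_measurable borel"
  by (intro borel_measurable_continuous_onI continuous_intros)

lemma L2_inner_integrable:
  assumes "u \<in> L2 M" "v \<in> L2 M"
  shows "integrable M (\<lambda>x. u x * cnj (v x))"
proof (rule Bochner_Integration.integrable_bound)
  show "integrable M (\<lambda>x. (cmod (u x))\<^sup>2 + (cmod (v x))\<^sup>2)"
    using assms by (intro Bochner_Integration.integrable_add) (simp_all add: L2_def)
  show "(\<lambda>x. u x * cnj (v x)) \<in> borel_measurable M"
    using assms[THEN L2_measurable] by measurable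
  have "cmod (u x) * cmod (v x) \<le> (cmod (u x))\<^sup>2 + (cmod (v x))\<^sup>2" for x
  proof -
    have "2 * (cmod (u x) * cmod (v x)) \<le> (cmod (u x))\<^sup>2 + (cmod (v x))\<^sup>2"
      using sum_squares_bound[of "cmod (u x)" "cmod (v x)"] by simp
    moreover have "0 \<le> cmod (u x) * cmod (v x)" by simp
    ultimately show ?thesis by linarith
  qed
  then show "AE x in M. norm (u x * cnj (v x)) \<le> norm ((cmod (u x))\<^sup>2 + (cmod (v x))\<^sup>2)"
    by (auto simp: norm_mult intro!: AE_I2)
qed

lemma L2_eq_zero_of_inner_self:
  assumes "u \<in> L2 M" "l2_inner M u u = 0"
  shows "AE x in M. u x = 0"
proof -
  have "l2_inner M u u = complex_of_real (LINT x|M. (cmod (u x))\<^sup>2)"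
    unfolding l2_inner_def by (simp add: complex_norm_square[symmetric] flip: of_real_power)
  with assms(2) have "(LINT x|M. (cmod (u x))\<^sup>2) = 0" by simp
  then show ?thesis
    using integral_nonneg_eq_0_iff_AE[OF L2_integrable[OF assms(1)]] by simp
qed

lemma nn_integral_L2_norm:
  assumes "u \<in> L2 M"
  shows "(\<integral>\<^sup>+x. ennreal ((cmod (u x))\<^sup>2) \<partial>M) = ennreal ((l2_norm M u)\<^sup>2)"
  using assms by (simp add: L2_def nn_integral_eq_integral l2_norm_def)

text \<open>Dominated convergence: the error is always 0 or \<open>- u x\<close>, and at each point
  it is 0 from some \<open>n\<close> on. For positive \<open>w\<close> the truncations lie in the
  domain of multiplication by \<open>w\<close>.\<close>

lemma L2_truncation_dense:
  fixes w :: "'a \<Rightarrow> real"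
  assumes u: "u \<in> L2 M" and [measurable]: "w \<in> borel_measurable M" and "e > 0"
  shows "\<exists>n::nat. l2_norm M (\<lambda>x. (if w x \<le> real n then u x else 0) - u x) < e"
proof -
  have [measurable]: "u \<in> borel_measurable M" using u by (rule L2_measurable)
  let ?d = "\<lambda>n x. (if w x \<le> real n then u x else 0) - u x"
  have "(\<lambda>n. LINT x|M. (cmod (?d n x))\<^sup>2) \<longlonglongrightarrow> (LINT x|M. 0)"
  proof (rule integral_dominated_convergence[OF _ _ L2_integrable[OF u]])
    show "AE x in M. (\<lambda>n. (cmod (?d n x))\<^sup>2) \<longlonglongrightarrow> 0"
    proof (rule AE_I2)
      fix x
      obtain m :: nat where "w x \<le> real m" using real_arch_simple by blast
      then have "eventually (\<lambda>n. (cmod (?d n x))\<^sup>2 = 0) sequentially"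
        by (intro eventually_sequentiallyI[of m]) auto
      then show "(\<lambda>n. (cmod (?d n x))\<^sup>2) \<longlonglongrightarrow> 0" by (rule tendsto_eventually)
    qed
  qed auto
  then have "(\<lambda>n. l2_norm M (?d n)) \<longlonglongrightarrow> 0"
    unfolding l2_norm_def by (auto intro: tendsto_eq_intros)
  then have "eventually (\<lambda>n. l2_norm M (?d n) < e) sequentially"
    using \<open>e > 0\<close> by (rule order_tendstoD)
  then show ?thesis by (auto dest: eventually_happens)
qed

subsection \<open>Weighted composition operators\<close>

text \<open>One shape for three operators: the composition operator (\<open>m\<close> constantly 1),
  multiplication by \<open>m\<close> (\<open>f\<close> the identity), and the isometric factor of
  the polar decomposition (\<open>m\<close> a reciprocal weight).\<close>

definition weighted_comp_op :: "'a measure \<Rightarrow> ('a \<Rightarrow> 'a) \<Rightarrow> ('a \<Rightarrow> real) \<Rightarrow> 'a l2op" where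
  "weighted_comp_op M f m =
     {(u, v). u \<in> L2 M \<and> v \<in> L2 M \<and> (AE x in M. v x = of_real (m x) * u (f x))}"

lemma comp_op_eq_weighted: "comp_op M f = weighted_comp_op M f (\<lambda>_. 1)"
  by (simp add: comp_op_def weighted_comp_op_def)

lemma nonsingular_id: "nonsingular M (\<lambda>x. x)"
  by (auto simp: nonsingular_def Int_absorb2 dest: sets.sets_into_space)

text \<open>Nonsingularity makes composition compatible with almost everywhere equality of
  representatives.\<close>

lemma l2_operator_weighted_comp_op:
  assumes f: "nonsingular M f"
  shows "l2_operator M (weighted_comp_op M f m)"
  unfolding l2_operator_def
proof (intro conjI)
  let ?A = "weighted_comp_op M f m"
  show "?A \<subseteq> L2 M \<times> L2 M" "((\<lambda>_. 0), (\<lambda>_. 0)) \<in> ?A"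
    by (auto simp: weighted_comp_op_def)
  show "\<forall>(u, v)\<in>?A. \<forall>(u', v')\<in>?A. \<forall>c. ((\<lambda>x. c * u x + u' x), (\<lambda>x. c * v x + v' x)) \<in> ?A"
  proof (clarify)
    fix u v u' v' c assume "(u, v) \<in> ?A" "(u', v') \<in> ?A"
    then have *: "u \<in> L2 M" "v \<in> L2 M" "u' \<in> L2 M" "v' \<in> L2 M"
      and v: "AE x in M. v x = of_real (m x) * u (f x)"
      and v': "AE x in M. v' x = of_real (m x) * u' (f x)"
      by (auto simp: weighted_comp_op_def)
    have "AE x in M. c * v x + v' x = of_real (m x) * (c * u (f x) + u' (f x))"
      using v v' by eventually_elim (simp add: algebra_simps)
    then show "((\<lambda>x. c * u x + u' x), (\<lambda>x. c * v x + v' x)) \<in> ?A"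
      using * by (simp add: weighted_comp_op_def L2_scale_add)
  qed
  show "\<forall>(u, v)\<in>?A. \<forall>u' v'. u' \<in> L2 M \<and> v' \<in> L2 M \<and> (AE x in M. u x = u' x) \<and>
         (AE x in M. v x = v' x) \<longrightarrow> (u', v') \<in> ?A"
  proof (clarify)
    fix u v u' v' assume "(u, v) \<in> ?A" and *: "u' \<in> L2 M" "v' \<in> L2 M"
      and u: "AE x in M. u x = u' x" and v: "AE x in M. v x = v' x"
    then have "AE x in M. v x = of_real (m x) * u (f x)" by (simp add: weighted_comp_op_def)
    with v AE_nonsingular[OF f u] have "AE x in M. v' x = of_real (m x) * u' (f x)"
      by eventually_elim simp
    with * show "(u', v') \<in> ?A" by (simp add: weighted_comp_op_def)
  qed
  have "AE x in M. v x = v' x" if "(u, v) \<in> ?A" "(u', v') \<in> ?A" and u: "AE x in M. u x = u' x"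
    for u v u' v'
  proof -
    from that have "AE x in M. v x = of_real (m x) * u (f x)" "AE x in M. v' x = of_real (m x) * u' (f x)"
      by (simp_all add: weighted_comp_op_def)
    with AE_nonsingular[OF f u] show ?thesis by eventually_elim simp
  qed
  then show "\<forall>(u, v)\<in>?A. \<forall>(u', v')\<in>?A. (AE x in M. u x = u' x) \<longrightarrow> (AE x in M. v x = v' x)"
    by blast
qed

section \<open>Multiplication by a positive weight as a positive selfadjoint operator\<close>

lemma densely_defined_mult_op:
  assumes [measurable]: "w \<in> borel_measurable M" and w: "\<And>x. w x > 0"
  shows "densely_defined M (weighted_comp_op M (\<lambda>x. x) w)"
  unfolding densely_defined_def
proof (intro ballI allI impI)
  fix u and e :: real assume u: "u \<in> L2 M" and "e > 0"
  have [measurable]: "u \<in> borel_measurable M" using u by (rule L2_measurable)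
  \<comment> \<open>On {w \<le> n} multiplication by \<open>w\<close> is bounded by
    \<open>n\<close>, so cutting \<open>u\<close> off outside this set puts it into the
    domain.\<close>
  obtain n :: nat where n: "l2_norm M (\<lambda>x. (if w x \<le> real n then u x else 0) - u x) < e"
    using L2_truncation_dense[OF u assms(1) \<open>e > 0\<close>] by blast
  let ?u = "\<lambda>x. if w x \<le> real n then u x else 0"
  have "?u \<in> L2 M"
    by (rule L2_bound[OF u, where c = 1]) auto
  moreover have "(\<lambda>x. of_real (w x) * ?u x) \<in> L2 M"
  proof (rule L2_bound[OF u, where c = "real n"])
    show "AE x in M. cmod (of_real (w x) * ?u x) \<le> real n * cmod (u x)"
    proof (rule AE_I2)
      fix x
      show "cmod (of_real (w x) * ?u x) \<le> real n * cmod (u x)"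
        using w[of x] by (auto simp: norm_mult intro!: mult_right_mono)
    qed
  qed measurable
  ultimately have "(?u, \<lambda>x. of_real (w x) * ?u x) \<in> weighted_comp_op M (\<lambda>x. x) w"
    by (simp add: weighted_comp_op_def)
  then have "?u \<in> op_dom (weighted_comp_op M (\<lambda>x. x) w)"
    by (auto simp: op_dom_iff)
  with n show "\<exists>f\<in>op_dom (weighted_comp_op M (\<lambda>x. x) w). l2_norm M (\<lambda>x. f x - u x) < e"
    by (intro bexI[of _ ?u])
qed

lemma op_adjoint_mult_op:
  assumes [measurable]: "w \<in> borel_measurable M" and w: "\<And>x. w x > 0"
  shows "op_adjoint M (weighted_comp_op M (\<lambda>x. x) w) = weighted_comp_op M (\<lambda>x. x) w"
    (is "op_adjoint M ?B = ?B")
proof (intro set_eqI iffI; clarify)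
  fix g h assume gh: "(g, h) \<in> ?B"
  then have g: "g \<in> L2 M" "h \<in> L2 M" and h: "AE x in M. h x = of_real (w x) * g x"
    by (auto simp: weighted_comp_op_def)
  note [measurable] = g[THEN L2_measurable]
  have "l2_inner M v g = l2_inner M u h" if "(u, v) \<in> ?B" for u v
  proof -
    from that have u: "u \<in> L2 M" "v \<in> L2 M" and v: "AE x in M. v x = of_real (w x) * u x"
      by (auto simp: weighted_comp_op_def)
    note [measurable] = u[THEN L2_measurable]
    from h v have "AE x in M. v x * cnj (g x) = u x * cnj (h x)"
      by eventually_elim simp
    then show ?thesis
      unfolding l2_inner_def by (intro integral_cong_AE) measurable
  qed
  with g show "(g, h) \<in> op_adjoint M ?B" by (auto simp: op_adjoint_def)
next
  fix g h assume "(g, h) \<in> op_adjoint M ?B"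
  then have g: "g \<in> L2 M" "h \<in> L2 M"
    and adj: "\<And>u v. (u, v) \<in> ?B \<Longrightarrow> l2_inner M v g = l2_inner M u h"
    by (auto simp: op_adjoint_def)
  note [measurable] = g[THEN L2_measurable]
  have "AE x in M. w x \<le> real n \<longrightarrow> h x = of_real (w x) * g x" for n :: nat
  proof -
    \<comment> \<open>The test function is the defect w g - h cut off to {w \<le> n}. It lies in the
      domain, and the adjoint relation then says that its own norm is 0.\<close>
    define u where "u x = (if w x \<le> real n then of_real (w x) * g x - h x else 0)" for x
    have [measurable]: "u \<in> borel_measurable M" unfolding u_def by measurable
    have "(\<lambda>x. if w x \<le> real n then of_real (w x) * g x else 0) \<in> L2 M"
    proof (rule L2_bound[OF g(1), where c = "real n"])
      show "AE x in M. cmod (if w x \<le> real n then of_real (w x) * g x else 0) \<le> real n * cmod (g x)"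
        using w by (auto simp: norm_mult abs_of_pos intro!: AE_I2 mult_right_mono)
    qed measurable
    moreover have "(\<lambda>x. if w x \<le> real n then h x else 0) \<in> L2 M"
      by (rule L2_bound[OF g(2), where c = 1]) auto
    ultimately have "(\<lambda>x. (if w x \<le> real n then of_real (w x) * g x else 0)
        - (if w x \<le> real n then h x else 0)) \<in> L2 M"
      by (rule L2_diff)
    also have "(\<lambda>x. (if w x \<le> real n then of_real (w x) * g x else 0)
        - (if w x \<le> real n then h x else 0)) = u"
      by (auto simp: u_def fun_eq_iff)
    finally have u: "u \<in> L2 M" .
    have wu: "(\<lambda>x. of_real (w x) * u x) \<in> L2 M"
    proof (rule L2_bound[OF u, where c = "real n"])
      show "AE x in M. cmod (of_real (w x) * u x) \<le> real n * cmod (u x)"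
        using w by (auto simp: u_def norm_mult abs_of_pos intro!: AE_I2 mult_right_mono)
    qed measurable
    have "l2_inner M (\<lambda>x. of_real (w x) * u x) g = l2_inner M u h"
      using u wu by (intro adj) (simp add: weighted_comp_op_def)
    then have "0 = (LINT x|M. of_real (w x) * u x * cnj (g x)) - (LINT x|M. u x * cnj (h x))"
      by (simp add: l2_inner_def)
    also have "\<dots> = (LINT x|M. of_real (w x) * u x * cnj (g x) - u x * cnj (h x))"
      using L2_inner_integrable[OF wu g(1)] L2_inner_integrable[OF u g(2)]
      by (simp add: Bochner_Integration.integral_diff)
    also have "\<dots> = (LINT x|M. u x * cnj (u x))"
      by (intro Bochner_Integration.integral_cong) (auto simp: u_def algebra_simps)
    finally have "l2_inner M u u = 0" by (simp add: l2_inner_def)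
    from L2_eq_zero_of_inner_self[OF u this] show ?thesis
      by eventually_elim (auto simp: u_def)
  qed
  then have "AE x in M. \<forall>n. w x \<le> real n \<longrightarrow> h x = of_real (w x) * g x"
    unfolding AE_all_countable by blast
  then have "AE x in M. h x = of_real (w x) * g x"
    by eventually_elim (meson real_arch_simple)
  with g show "(g, h) \<in> ?B" by (simp add: weighted_comp_op_def)
qed

lemma positive_mult_op:
  assumes [measurable]: "w \<in> borel_measurable M" and w: "\<And>x. w x > 0"
  shows "positive_op M (weighted_comp_op M (\<lambda>x. x) w)"
  unfolding positive_op_def
proof (clarify, intro conjI)
  fix u v assume "(u, v) \<in> weighted_comp_op M (\<lambda>x. x) w"
  then have u: "u \<in> L2 M" "v \<in> L2 M" and v: "AE x in M. v x = of_real (w x) * u x"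
    by (auto simp: weighted_comp_op_def)
  note [measurable] = u[THEN L2_measurable]
  have "l2_inner M v u = (LINT x|M. complex_of_real (w x * (cmod (u x))\<^sup>2))"
    unfolding l2_inner_def
  proof (rule integral_cong_AE)
    show "AE x in M. v x * cnj (u x) = complex_of_real (w x * (cmod (u x))\<^sup>2)"
      using v by eventually_elim (simp only: of_real_mult complex_norm_square mult.assoc)
  qed measurable
  also have "\<dots> = complex_of_real (LINT x|M. w x * (cmod (u x))\<^sup>2)"
    by (rule integral_complex_of_real)
  finally have *: "l2_inner M v u = complex_of_real (LINT x|M. w x * (cmod (u x))\<^sup>2)" .
  have "0 \<le> (LINT x|M. w x * (cmod (u x))\<^sup>2)"
    using w by (intro Bochner_Integration.integral_nonneg mult_nonneg_nonneg) (auto intro: less_imp_le)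
  then show "Im (l2_inner M v u) = 0" "0 \<le> Re (l2_inner M v u)"
    by (simp_all add: *)
qed


lemma selfadjoint_mult_op:
  assumes "w \<in> borel_measurable M" "\<And>x. w x > 0"
  shows "selfadjoint_op M (weighted_comp_op M (\<lambda>x. x) w)"
  unfolding selfadjoint_op_def
  using assms by (intro conjI l2_operator_weighted_comp_op nonsingular_id densely_defined_mult_op op_adjoint_mult_op)

subsection \<open>Quasinormal composition operators\<close>

text \<open>\<open>change_of_variables\<close> says that the square of \<open>w\<close> is the
  density of \<open>f\<close>. Composition with \<open>f\<close> then factors into multiplication by
  \<open>w\<close> and the isometry sending u to (u o f) / w. Positivity and invariance hold at
  every point, so that weights can be cancelled pointwise.\<close>

locale invariant_weight =
  fixes M :: "'a measure" and f :: "'a \<Rightarrow> 'a" and w :: "'a \<Rightarrow> real"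
  assumes nonsingular: "nonsingular M f"
    and w_measurable[measurable]: "w \<in> borel_measurable M"
    and w_pos: "w x > 0"
    and w_invariant: "w (f x) = w x"
    and change_of_variables:
      "g \<in> borel_measurable M \<Longrightarrow> (\<integral>\<^sup>+x. g (f x) \<partial>M) = (\<integral>\<^sup>+x. ennreal ((w x)\<^sup>2) * g x \<partial>M)"
begin

abbreviation "mult_w \<equiv> weighted_comp_op M (\<lambda>x. x) w"
abbreviation "isom \<equiv> weighted_comp_op M f (\<lambda>x. 1 / w x)"

lemma f_measurable[measurable]: "f \<in> measurable M M"
  by (rule nonsingular_measurable[OF nonsingular])

lemma comp_measurable: "u \<in> borel_measurable M \<Longrightarrow> (\<lambda>x. u (f x)) \<in> borel_measurable M"
  by (rule measurable_compose[OF f_measurable])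

text \<open>By invariance 1 / w(x) equals 1 / w(f(x)), so the integrand depends on f(x) alone; the
  change of variables brings in the square of \<open>w\<close>, which cancels.\<close>

lemma nn_integral_isom:
  assumes [measurable]: "u \<in> borel_measurable M"
  shows "(\<integral>\<^sup>+x. ennreal ((cmod (of_real (1 / w x) * u (f x)))\<^sup>2) \<partial>M) = (\<integral>\<^sup>+x. ennreal ((cmod (u x))\<^sup>2) \<partial>M)"
proof -
  have "(\<integral>\<^sup>+x. ennreal ((cmod (of_real (1 / w x) * u (f x)))\<^sup>2) \<partial>M) =
      (\<integral>\<^sup>+x. ennreal ((cmod (of_real (1 / w (f x)) * u (f x)))\<^sup>2) \<partial>M)"
    by (simp add: w_invariant)
  also have "\<dots> = (\<integral>\<^sup>+x. ennreal ((w x)\<^sup>2) * ennreal ((cmod (of_real (1 / w x) * u x))\<^sup>2) \<partial>M)"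
    by (rule change_of_variables[where g = "\<lambda>x. ennreal ((cmod (of_real (1 / w x) * u x))\<^sup>2)"]) measurable
  also have "\<dots> = (\<integral>\<^sup>+x. ennreal ((cmod (u x))\<^sup>2) \<partial>M)"
  proof (rule nn_integral_cong)
    fix x
    show "ennreal ((w x)\<^sup>2) * ennreal ((cmod (of_real (1 / w x) * u x))\<^sup>2) = ennreal ((cmod (u x))\<^sup>2)"
      using w_pos[of x] by (simp add: norm_mult norm_divide power_mult_distrib power_divide ennreal_mult[symmetric])
  qed
  finally show ?thesis .
qed

lemma L2_isom: "u \<in> L2 M \<Longrightarrow> (\<lambda>x. of_real (1 / w x) * u (f x)) \<in> L2 M"
  unfolding L2_iff_nn_integral
  using nn_integral_isom[of u] comp_measurable[of u] by auto

text \<open>The change of variables identifies the two norms. Hence composition with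
  \<open>f\<close> and multiplication by \<open>w\<close> have the same domain.\<close>

lemma L2_comp_iff:
  assumes u: "u \<in> borel_measurable M"
  shows "(\<lambda>x. u (f x)) \<in> L2 M \<longleftrightarrow> (\<lambda>x. of_real (w x) * u x) \<in> L2 M"
proof -
  note [measurable] = u
  have "(\<integral>\<^sup>+x. ennreal ((cmod (u (f x)))\<^sup>2) \<partial>M) = (\<integral>\<^sup>+x. ennreal ((w x)\<^sup>2) * ennreal ((cmod (u x))\<^sup>2) \<partial>M)"
    by (rule change_of_variables[where g = "\<lambda>x. ennreal ((cmod (u x))\<^sup>2)"]) measurable
  also have "\<dots> = (\<integral>\<^sup>+x. ennreal ((cmod (of_real (w x) * u x))\<^sup>2) \<partial>M)"
    by (simp add: norm_mult power_mult_distrib ennreal_mult)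
  finally show ?thesis
    using u comp_measurable[OF u] by (simp add: L2_iff_nn_integral)
qed

lemma partial_isometry_isom: "partial_isometry M isom"
  unfolding partial_isometry_def
proof (intro conjI)
  show "l2_operator M isom" by (rule l2_operator_weighted_comp_op[OF nonsingular])
  have "u \<in> op_dom isom" if "u \<in> L2 M" for u
    using that L2_isom[OF that] unfolding op_dom_iff
    by (intro exI[of _ "\<lambda>x. of_real (1 / w x) * u (f x)"]) (simp add: weighted_comp_op_def)
  then show "op_dom isom = L2 M"
    by (auto simp: op_dom_iff weighted_comp_op_def)
  have "l2_norm M v = l2_norm M u" if "(u, v) \<in> isom" for u v
  proof -
    from that have u: "u \<in> L2 M" "v \<in> L2 M" and v: "AE x in M. v x = of_real (1 / w x) * u (f x)"
      by (auto simp: weighted_comp_op_def)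
    have "(\<integral>\<^sup>+x. ennreal ((cmod (v x))\<^sup>2) \<partial>M) = (\<integral>\<^sup>+x. ennreal ((cmod (of_real (1 / w x) * u (f x)))\<^sup>2) \<partial>M)"
      by (rule nn_integral_cong_AE) (use v in eventually_elim, simp)
    also have "\<dots> = (\<integral>\<^sup>+x. ennreal ((cmod (u x))\<^sup>2) \<partial>M)"
      by (rule nn_integral_isom[OF L2_measurable[OF u(1)]])
    finally have "(l2_norm M v)\<^sup>2 = (l2_norm M u)\<^sup>2"
      using u by (simp add: nn_integral_L2_norm)
    then show ?thesis
      by (rule power2_eq_imp_eq) (simp_all add: l2_norm_def Bochner_Integration.integral_nonneg)
  qed
  then show "\<forall>(u, v)\<in>isom. (\<forall>k\<in>op_ker isom. l2_inner M u k = 0) \<longrightarrow> l2_norm M v = l2_norm M u"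
    by blast
qed

lemma comp_op_eq_op_comp: "comp_op M f = op_comp isom mult_w"
proof (intro set_eqI iffI; clarify)
  fix u v assume "(u, v) \<in> comp_op M f"
  then have u: "u \<in> L2 M" "v \<in> L2 M" and v: "AE x in M. v x = u (f x)"
    by (auto simp: comp_op_def)
  have "(\<lambda>x. u (f x)) \<in> L2 M"
    by (rule L2_bound[OF u(2), where c = 1])
       (use v comp_measurable[OF L2_measurable[OF u(1)]] in auto)
  then have wu: "(\<lambda>x. of_real (w x) * u x) \<in> L2 M"
    by (simp add: L2_comp_iff L2_measurable[OF u(1)])
  have "AE x in M. v x = of_real (1 / w x) * (of_real (w (f x)) * u (f x))"
    using v
  proof eventually_elim
    case (elim x)
    then show ?case using w_pos[of x] by (simp add: w_invariant)
  qed
  then have "(\<lambda>x. of_real (w x) * u x, v) \<in> isom"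
    using wu u by (simp add: weighted_comp_op_def)
  moreover have "(u, \<lambda>x. of_real (w x) * u x) \<in> mult_w"
    using wu u by (simp add: weighted_comp_op_def)
  ultimately show "(u, v) \<in> op_comp isom mult_w"
    unfolding op_comp_def by blast
next
  fix u v assume "(u, v) \<in> op_comp isom mult_w"
  then obtain g where g: "(u, g) \<in> mult_w" "(g, v) \<in> isom"
    by (auto simp: op_comp_def)
  then have "AE x in M. g (f x) = of_real (w (f x)) * u (f x)" "AE x in M. v x = of_real (1 / w x) * g (f x)"
    using AE_nonsingular[OF nonsingular, of "\<lambda>x. g x = of_real (w x) * u x"]
    by (auto simp: weighted_comp_op_def)
  then have "AE x in M. v x = u (f x)"
  proof eventually_elim
    case (elim x)
    then show ?case using w_pos[of x] by (simp add: w_invariant)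
  qed
  with g show "(u, v) \<in> comp_op M f"
    by (simp add: comp_op_def weighted_comp_op_def)
qed

lemma polar_decomposition_comp_op: "polar_decomposition M (comp_op M f) isom mult_w"
  unfolding polar_decomposition_def
proof (intro conjI partial_isometry_isom selfadjoint_mult_op positive_mult_op comp_op_eq_op_comp
    w_measurable w_pos)
  have w0: "w x \<noteq> 0" for x
    using w_pos[of x] by simp
  \<comment> \<open>Both kernels consist of null functions: \<open>isom\<close> preserves norms, and
    \<open>w\<close> never vanishes.\<close>
  have "AE x in M. u x = 0" if u: "u \<in> L2 M" and z: "AE x in M. u (f x) = 0" for u
  proof -
    have "(\<integral>\<^sup>+x. ennreal ((cmod (u x))\<^sup>2) \<partial>M) = (\<integral>\<^sup>+x. ennreal ((cmod (of_real (1 / w x) * u (f x)))\<^sup>2) \<partial>M)"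
      by (rule nn_integral_isom[OF L2_measurable[OF u], symmetric])
    also have "\<dots> = (\<integral>\<^sup>+x. 0 \<partial>M)"
      by (rule nn_integral_cong_AE, use z in eventually_elim) simp
    finally have "(\<integral>\<^sup>+x. ennreal ((cmod (u x))\<^sup>2) \<partial>M) = 0" by simp
    then have "AE x in M. ennreal ((cmod (u x))\<^sup>2) = 0"
      using L2_measurable[OF u] by (subst nn_integral_0_iff_AE[symmetric]) auto
    then show ?thesis by eventually_elim simp
  qed
  moreover have "AE x in M. u (f x) = 0" if "AE x in M. u x = (0::complex)" for u
    by (rule AE_nonsingular[OF nonsingular that])
  ultimately have "u \<in> L2 M \<Longrightarrow> (AE x in M. u (f x) = 0) \<longleftrightarrow> (AE x in M. u x = 0)" for u
    by blast
  then show "op_ker isom = op_ker mult_w"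
    by (simp add: op_ker_def weighted_comp_op_def w0 cong: conj_cong)
qed

text \<open>In the opposite order the weights cancel too: w times (u o f) / w is u o f.\<close>

lemma isom_commutes: "op_comp isom mult_w \<subseteq> op_comp mult_w isom"
proof (clarify)
  fix u v assume "(u, v) \<in> op_comp isom mult_w"
  then have u: "u \<in> L2 M" "v \<in> L2 M" and v: "AE x in M. v x = u (f x)"
    by (auto simp: comp_op_eq_op_comp[symmetric] comp_op_def)
  let ?k = "\<lambda>x. of_real (1 / w x) * u (f x)"
  have "(u, ?k) \<in> isom"
    using u L2_isom by (simp add: weighted_comp_op_def)
  moreover have "AE x in M. v x = of_real (w x) * ?k x"
    using v
  proof eventually_elim
    case (elim x)
    then show ?case using w_pos[of x] by simp
  qed
  then have "(?k, v) \<in> mult_w"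
    using u L2_isom by (simp add: weighted_comp_op_def)
  ultimately show "(u, v) \<in> op_comp mult_w isom"
    unfolding op_comp_def by blast
qed

text \<open>If F_n tends to u and F_n o f to v, it is not clear beforehand that u o f is square
  integrable. The squared modulus of v - u o f is therefore integrated against a positive damping
  weight; the result is bounded by the two errors and hence is 0.\<close>

lemma closed_comp_op: "closed_op M (comp_op M f)"
  unfolding closed_op_def
proof (intro allI impI, elim conjE)
  fix F G u v
  assume FG: "\<forall>n::nat. (F n, G n) \<in> comp_op M f" and u: "u \<in> L2 M" and v: "v \<in> L2 M"
    and F0: "(\<lambda>n. l2_norm M (\<lambda>x. F n x - u x)) \<longlonglongrightarrow> 0"
    and G0: "(\<lambda>n. l2_norm M (\<lambda>x. G n x - v x)) \<longlonglongrightarrow> 0"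
  have F: "F n \<in> L2 M" and G: "G n \<in> L2 M" and FG: "AE x in M. G n x = F n (f x)" for n
    using FG by (auto simp: comp_op_def)
  note [measurable] = u[THEN L2_measurable] v[THEN L2_measurable] F[THEN L2_measurable] G[THEN L2_measurable]
  \<comment> \<open>the weight makes both the multiplication and the composition part contractive\<close>
  define m where "m x = min 1 (1 / (w x)\<^sup>2)" for x
  have [measurable]: "m \<in> borel_measurable M" unfolding m_def by measurable
  have m: "0 < m x" "m x \<le> 1" "m x \<le> 1 / (w x)\<^sup>2" for x
    using w_pos[of x] by (auto simp: m_def)
  have bound: "(\<integral>\<^sup>+x. ennreal (m x * (cmod (v x - u (f x)))\<^sup>2) \<partial>M) \<le>
      ennreal (2 * (l2_norm M (\<lambda>x. G n x - v x))\<^sup>2 + 2 * (l2_norm M (\<lambda>x. F n x - u x))\<^sup>2)" for n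
  proof -
    have "(\<integral>\<^sup>+x. ennreal (m x * (cmod (v x - u (f x)))\<^sup>2) \<partial>M) \<le>
        (\<integral>\<^sup>+x. 2 * ennreal ((cmod (G n x - v x))\<^sup>2) +
          2 * ennreal ((cmod (of_real (1 / w x) * (F n (f x) - u (f x))))\<^sup>2) \<partial>M)"
    proof (rule nn_integral_mono_AE)
      show "AE x in M. ennreal (m x * (cmod (v x - u (f x)))\<^sup>2) \<le> 2 * ennreal ((cmod (G n x - v x))\<^sup>2) +
          2 * ennreal ((cmod (of_real (1 / w x) * (F n (f x) - u (f x))))\<^sup>2)"
        using FG[of n]
      proof eventually_elim
        case (elim x)
        let ?a = "(cmod (G n x - v x))\<^sup>2" and ?b = "(cmod (F n (f x) - u (f x)))\<^sup>2"
        have "(cmod (v x - u (f x)))\<^sup>2 \<le> 2 * ?a + 2 * ?b"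
          using norm_add_square_le[of "v x - G n x" "F n (f x) - u (f x)"]
          by (simp add: elim norm_minus_commute)
        then have "m x * (cmod (v x - u (f x)))\<^sup>2 \<le> m x * (2 * ?a + 2 * ?b)"
          using m(1)[of x] by (intro mult_left_mono) auto
        also have "\<dots> \<le> 2 * ?a + 2 * (1 / (w x)\<^sup>2 * ?b)"
          using mult_right_mono[OF m(2)[of x], of ?a] mult_right_mono[OF m(3)[of x], of ?b]
          by (simp add: algebra_simps)
        also have "1 / (w x)\<^sup>2 * ?b = (cmod (of_real (1 / w x) * (F n (f x) - u (f x))))\<^sup>2"
          by (simp add: norm_mult norm_divide power_mult_distrib power_divide)
        finally show ?case
          by (simp add: ennreal_plus[symmetric] ennreal_mult'[symmetric] del: ennreal_plus 
              flip: ennreal_numeral)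
      qed
    qed
    also have "\<dots> = 2 * (\<integral>\<^sup>+x. ennreal ((cmod (G n x - v x))\<^sup>2) \<partial>M) +
        2 * (\<integral>\<^sup>+x. ennreal ((cmod (of_real (1 / w x) * (F n (f x) - u (f x))))\<^sup>2) \<partial>M)"
      by (simp add: nn_integral_add nn_integral_cmult)
    also have "\<dots> = 2 * (\<integral>\<^sup>+x. ennreal ((cmod (G n x - v x))\<^sup>2) \<partial>M) +
        2 * (\<integral>\<^sup>+x. ennreal ((cmod (F n x - u x))\<^sup>2) \<partial>M)"
      by (subst nn_integral_isom[where u = "\<lambda>x. F n x - u x"]) auto
    also have "\<dots> = ennreal (2 * (l2_norm M (\<lambda>x. G n x - v x))\<^sup>2 + 2 * (l2_norm M (\<lambda>x. F n x - u x))\<^sup>2)"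
      by (simp add: nn_integral_L2_norm L2_diff F G u v ennreal_mult)
    finally show ?thesis .
  qed
  have "(\<lambda>n. ennreal (2 * (l2_norm M (\<lambda>x. G n x - v x))\<^sup>2 + 2 * (l2_norm M (\<lambda>x. F n x - u x))\<^sup>2))
      \<longlonglongrightarrow> ennreal (2 * 0\<^sup>2 + 2 * 0\<^sup>2)"
    by (intro tendsto_ennrealI tendsto_intros F0 G0)
  then have "(\<integral>\<^sup>+x. ennreal (m x * (cmod (v x - u (f x)))\<^sup>2) \<partial>M) \<le> 0"
    using bound by (intro LIMSEQ_le_const) auto
  then have "AE x in M. ennreal (m x * (cmod (v x - u (f x)))\<^sup>2) = 0"
    by (subst nn_integral_0_iff_AE[symmetric]) auto
  then have "AE x in M. v x = u (f x)"
  proof eventually_elim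
    case (elim x)
    then show ?case using m(1)[of x] by (auto simp: ennreal_eq_0_iff mult_le_0_iff)
  qed
  with u v show "(u, v) \<in> comp_op M f" by (simp add: comp_op_def)
qed

lemma quasinormal_comp_op: "quasinormal M (comp_op M f)"
  unfolding quasinormal_def
proof (intro conjI exI)
  show "l2_operator M (comp_op M f)"
    unfolding comp_op_eq_weighted by (rule l2_operator_weighted_comp_op[OF nonsingular])
  \<comment> \<open>The isometry is defined everywhere, so the composition operator inherits the
    dense domain of multiplication by \<open>w\<close>.\<close>
  have "\<exists>v. (g, v) \<in> isom" if "(u, g) \<in> mult_w" for u g
  proof -
    have "g \<in> op_dom isom"
      using that partial_isometry_isom by (simp add: partial_isometry_def weighted_comp_op_def)
    then show ?thesis by (simp add: op_dom_iff)
  qed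
  then have "(\<exists>v g. (u, g) \<in> mult_w \<and> (g, v) \<in> isom) \<longleftrightarrow> (\<exists>g. (u, g) \<in> mult_w)" for u
    by blast
  then have "op_dom (comp_op M f) = op_dom mult_w"
    by (simp add: comp_op_eq_op_comp set_eq_iff op_dom_iff op_comp_def)
  then show "densely_defined M (comp_op M f)"
    using densely_defined_mult_op[OF w_measurable w_pos] by (simp add: densely_defined_def)
qed (rule closed_comp_op polar_decomposition_comp_op isom_commutes)+

end

section \<open>Positivity of the density forced by quasinormality\<close>

text \<open>With \<open>A = U B\<close>, quasinormality gives \<open>A \<subseteq> B U\<close>, so the range of \<open>A\<close> lies in the range of
  \<open>B\<close>, which is orthogonal to the kernel of \<open>B\<close>; the latter contains the kernel of \<open>A\<close>.\<close>
lemma quasinormal_range_orthogonal_ker: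
  assumes "quasinormal M A" "(u, v) \<in> A" "k \<in> op_ker A"
  shows "l2_inner M v k = 0"
proof -
  obtain U B where pd: "polar_decomposition M A U B" and comm: "op_comp U B \<subseteq> op_comp B U"
    using assms(1) by (auto simp: quasinormal_def)
  then have A: "A = op_comp U B" and ker: "op_ker U = op_ker B" and adj: "op_adjoint M B = B"
    by (auto simp: polar_decomposition_def selfadjoint_op_def)
  from assms(2) comm A obtain g where g: "(u, g) \<in> U" "(g, v) \<in> B"
    by (auto simp: op_comp_def)
  from assms(3) A obtain b where b: "(k, b) \<in> B" "(b, \<lambda>_. 0) \<in> U"
    by (auto simp: op_comp_def op_ker_def)
  from b(2) ker have b0: "(b, \<lambda>_. 0) \<in> B"
    by (auto simp: op_ker_def)
  have eq: "l2_inner M y k = l2_inner M x b" if "(x, y) \<in> B" for x y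
    using b(1) that by (subst (asm) adj[symmetric]) (auto simp: op_adjoint_def)
  have "b \<in> L2 M" and g2: "g \<in> L2 M"
    using b(1) g(2) adj by (auto simp: op_adjoint_def)
  moreover have "l2_inner M b b = 0"
    using eq[OF b0] by (simp add: l2_inner_def)
  ultimately have "AE x in M. b x = 0"
    by (intro L2_eq_zero_of_inner_self)
  then have "AE x in M. g x * cnj (b x) = 0"
    by eventually_elim simp
  then have "l2_inner M g b = 0"
    unfolding l2_inner_def by (rule integral_eq_zero_AE)
  with eq[OF g(2)] show ?thesis by simp
qed

text \<open>A strictly positive function in the range is orthogonal to \<open>k\<close>, which lies
  in the kernel and is strictly positive exactly on {h = 0}. The integral of their product can
  vanish only if {h = 0} is null.\<close>

lemma (in sigma_finite_measure) hRN_pos_of_quasinormal: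
  assumes f: "nonsingular M f" and fin: "AE x in M. hRN M f x \<noteq> \<infinity>"
    and qn: "quasinormal M (comp_op M f)"
  shows "AE x in M. 0 < hRN M f x"
proof -
  have [measurable]: "f \<in> measurable M M" by (rule nonsingular_measurable[OF f])
  obtain k0 :: "'a \<Rightarrow> real" where [measurable]: "k0 \<in> borel_measurable M"
    and k0: "\<And>x. k0 x > 0" "\<And>x. k0 x \<le> 1" "integrable M k0"
    using obtain_positive_integrable_function by blast
  \<comment> \<open>A positive \<open>u0\<close> integrable against 1 + h has a square root that is
    square integrable both before and after composition with \<open>f\<close>. Finiteness of h gives
    the \<sigma>-finiteness from which such a function is obtained.\<close>
  have "sigma_finite_measure (density M (\<lambda>x. 1 + hRN M f x))"
    using fin by (subst sigma_finite_iff_density_finite) auto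
  then interpret D: sigma_finite_measure "density M (\<lambda>x. 1 + hRN M f x)" .
  obtain u0 :: "'a \<Rightarrow> real" where "u0 \<in> borel_measurable (density M (\<lambda>x. 1 + hRN M f x))"
    and u0: "\<And>x. u0 x > 0" "\<And>x. u0 x \<le> 1" "integrable (density M (\<lambda>x. 1 + hRN M f x)) u0"
    using D.obtain_positive_integrable_function by blast
  then have [measurable]: "u0 \<in> borel_measurable M" by simp
  have "(\<integral>\<^sup>+x. (1 + hRN M f x) * ennreal (u0 x) \<partial>M) < \<infinity>"
    using u0 by (simp add: integrable_iff_bounded nn_integral_density abs_of_pos)
  then have "(\<integral>\<^sup>+x. ennreal (u0 x) \<partial>M) + (\<integral>\<^sup>+x. hRN M f x * ennreal (u0 x) \<partial>M) < \<infinity>"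
    by (simp add: distrib_right nn_integral_add)
  then have fin1: "(\<integral>\<^sup>+x. ennreal (u0 x) \<partial>M) < \<infinity>" and fin2: "(\<integral>\<^sup>+x. hRN M f x * ennreal (u0 x) \<partial>M) < \<infinity>"
    by auto
  let ?u = "\<lambda>x. complex_of_real (sqrt (u0 x))"
  define k where "k x = (if hRN M f x = 0 then complex_of_real (sqrt (k0 x)) else 0)" for x
  have [measurable]: "k \<in> borel_measurable M" unfolding k_def by measurable
  have u: "?u \<in> L2 M"
    using fin1 u0(1) by (simp add: L2_iff_nn_integral abs_of_nonneg less_imp_le[OF u0(1)])
  have uf: "(\<lambda>x. ?u (f x)) \<in> L2 M"
    using fin2 u0(1) nn_integral_nonsingular[OF f, of "\<lambda>x. ennreal (u0 x)"]
    by (simp add: L2_iff_nn_integral abs_of_nonneg less_imp_le[OF u0(1)])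
  have k: "k \<in> L2 M"
  proof (rule L2_bound[where c = 1])
    show "(\<lambda>x. complex_of_real (sqrt (k0 x))) \<in> L2 M"
      using k0 by (simp add: L2_def abs_of_nonneg less_imp_le[OF k0(1)])
  qed (auto simp: k_def)
  have "AE x in M. k (f x) = 0"
    \<comment> \<open>Almost every point is mapped into {h > 0}, where \<open>k\<close>
      vanishes.\<close>
    by (subst AE_nonsingular_iff[OF f]) (auto simp: k_def)
  then have "k \<in> op_ker (comp_op M f)"
    using k by (auto simp: op_ker_def comp_op_def)
  moreover have "(?u, \<lambda>x. ?u (f x)) \<in> comp_op M f"
    using u uf by (simp add: comp_op_def)
  ultimately have "l2_inner M (\<lambda>x. ?u (f x)) k = 0"
    by (intro quasinormal_range_orthogonal_ker[OF qn])
  moreover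
  define d where "d x = (if hRN M f x = 0 then sqrt (u0 (f x)) * sqrt (k0 x) else 0)" for x
  have d: "?u (f x) * cnj (k x) = complex_of_real (d x)" for x
    by (simp add: d_def k_def)
  ultimately have "complex_of_real (LINT x|M. d x) = 0"
    unfolding l2_inner_def d by simp
  then have "(LINT x|M. d x) = 0"
    by (simp only: of_real_eq_0_iff)
  moreover have "integrable M d"
    using integrable_Re[OF L2_inner_integrable[OF uf k]] unfolding d Re_complex_of_real .
  moreover have "AE x in M. 0 \<le> d x"
    by (simp add: d_def less_imp_le[OF u0(1)] less_imp_le[OF k0(1)])
  ultimately have "AE x in M. d x = 0"
    by (simp add: integral_nonneg_eq_0_iff_AE)
  then show ?thesis
  proof eventually_elim
    case (elim x)
    then show ?case
      using u0(1)[of "f x"] k0(1)[of x] by (cases "hRN M f x = 0") (simp_all add: d_def zero_less_iff_neq_zero)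
  qed
qed

subsection \<open>Conditional expectation along a transformation\<close>

lemma ennreal_times_divide_cancel:
  fixes a c :: ennreal
  assumes "c \<noteq> 0" "c < \<infinity>"
  shows "c * (a / c) = a"
proof -
  have "c * (a / c) = (a * c) / c"
    by (simp add: ennreal_times_divide mult.commute)
  also have "\<dots> = a"
    using assms by (intro ennreal_mult_divide_eq) auto
  finally show ?thesis .
qed

lemma ennreal_divide_right_cancel:
  fixes a b c :: ennreal
  assumes "0 < c" "c < \<infinity>"
  shows "a / c = b / c \<longleftrightarrow> a = b"
proof
  assume "a / c = b / c"
  then have "c * (a / c) = c * (b / c)" by (rule arg_cong)
  with assms show "a = b"
    by (simp only: ennreal_times_divide_cancel[OF less_imp_neq[OF assms(1), symmetric] assms(2)])
qed (rule arg_cong)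

lemma pdiv_pos: "0 < c \<Longrightarrow> pdiv a c = a / c"
  by (simp add: pdiv_def zero_less_iff_neq_zero)

lemma pdiv_measurable[measurable]:
  assumes [measurable]: "a \<in> borel_measurable M" "b \<in> borel_measurable M"
  shows "(\<lambda>x. pdiv (a x) (b x)) \<in> borel_measurable M"
  unfolding pdiv_def by measurable

text \<open>For measurable \<open>g\<close>, nonsingular \<open>f\<close> and finite h this is h
  times E(g) o f^-1; for g = 1 it is h itself.\<close>

definition push_density :: "'a measure \<Rightarrow> ('a \<Rightarrow> 'a) \<Rightarrow> ('a \<Rightarrow> ennreal) \<Rightarrow> 'a \<Rightarrow> ennreal" where
  "push_density M f g = RN_deriv M (distr (density M g) M f)"

lemma push_density_measurable[measurable]: "push_density M f g \<in> borel_measurable M"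
  unfolding push_density_def by simp

lemma (in sigma_finite_measure) density_push_density:
  assumes f: "nonsingular M f" and g: "g \<in> borel_measurable M"
  shows "density M (push_density M f g) = distr (density M g) M f"
  unfolding push_density_def
proof (rule density_RN_deriv)
  have [measurable]: "f \<in> measurable M M" by (rule nonsingular_measurable[OF f])
  show "absolutely_continuous M (distr (density M g) M f)"
    unfolding absolutely_continuous_def
  proof
    fix D assume D: "D \<in> null_sets M"
    then have "f -` D \<inter> space M \<in> null_sets M"
      using f by (auto simp: nonsingular_def null_sets_def)
    then have "f -` D \<inter> space M \<in> null_sets (density M g)"
      using absolutely_continuousI_density[OF g] by (auto simp: absolutely_continuous_def)
    with D show "D \<in> null_sets (distr (density M g) M f)"
      by (auto simp: null_sets_def emeasure_distr)
  qed
qed simp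

lemma (in sigma_finite_measure) set_nn_integral_push_density:
  assumes f: "nonsingular M f" and g[measurable]: "g \<in> borel_measurable M" and [measurable]: "D \<in> sets M"
  shows "(\<integral>\<^sup>+x\<in>D. push_density M f g x \<partial>M) = (\<integral>\<^sup>+x\<in>f -` D \<inter> space M. g x \<partial>M)"
proof -
  have [measurable]: "f \<in> measurable M M" by (rule nonsingular_measurable[OF f])
  have "(\<integral>\<^sup>+x\<in>D. push_density M f g x \<partial>M) = emeasure (density M (push_density M f g)) D"
    by (simp add: emeasure_density)
  also have "\<dots> = (\<integral>\<^sup>+x\<in>f -` D \<inter> space M. g x \<partial>M)"
    by (simp add: density_push_density[OF f g] emeasure_distr emeasure_density)
  finally show ?thesis .
qed

text \<open>Almost every point is mapped into {h > 0}, so the preimage of {h = 0} is null and the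
  density integrates to 0 over {h = 0}.\<close>

lemma (in sigma_finite_measure) push_density_eq_0:
  assumes f: "nonsingular M f" and g[measurable]: "g \<in> borel_measurable M"
  shows "AE x in M. hRN M f x = 0 \<longrightarrow> push_density M f g x = 0"
proof -
  have [measurable]: "f \<in> measurable M M" by (rule nonsingular_measurable[OF f])
  have "AE x in M. 0 < hRN M f (f x)"
    by (subst AE_nonsingular_iff[OF f]) auto
  then have "AE x in M. g x * indicator (f -` {x\<in>space M. hRN M f x = 0} \<inter> space M) x = 0"
    by eventually_elim (auto simp: indicator_def)
  then have "(\<integral>\<^sup>+x\<in>{x\<in>space M. hRN M f x = 0}. push_density M f g x \<partial>M) = 0"
    by (subst set_nn_integral_push_density[OF f g]) (auto simp: nn_integral_0_iff_AE)
  then have "AE x in M. push_density M f g x * indicator {x\<in>space M. hRN M f x = 0} x = 0"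
    by (subst (asm) nn_integral_0_iff_AE) auto
  with AE_space show ?thesis
    by eventually_elim (auto simp: indicator_def)
qed

section \<open>Conditional expectation given the preimage algebra of \<open>f\<close>\<close>

lemma (in sigma_finite_measure) sigma_finite_subalgebra_vimage:
  assumes f: "nonsingular M f" and fin: "AE x in M. hRN M f x \<noteq> \<infinity>"
  shows "sigma_finite_subalgebra M (vimage_algebra (space M) f M)"
proof (rule sigma_finite_subalgebra.intro)
  let ?F = "vimage_algebra (space M) f M"
  have fM[measurable]: "f \<in> measurable M M" by (rule nonsingular_measurable[OF f])
  have fS: "f \<in> space M \<rightarrow> space M" using measurable_space[OF fM] by auto
  show sub: "subalgebra M ?F"
    unfolding subalgebra_def sets_vimage_algebra2[OF fS] by auto
  let ?G = "restr_to_subalg M ?F"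
  have fG: "f \<in> measurable ?G M"
    by (rule measurable_in_subalg[OF sub measurable_vimage_algebra1[OF fS]])
  \<comment> \<open>The image of the restricted measure still has density h. Finiteness of h makes
    this image \<sigma>-finite, and \<sigma>-finiteness pulls back along \<open>f\<close>.\<close>
  have "distr ?G M f = distr M M f"
  proof (rule measure_eqI)
    fix D assume "D \<in> sets (distr ?G M f)"
    then have D: "D \<in> sets M" by simp
    have "emeasure (distr ?G M f) D = emeasure ?G (f -` D \<inter> space M)"
      using emeasure_distr[OF fG D] by (simp only: space_restr_to_subalg)
    also have "\<dots> = emeasure M (f -` D \<inter> space M)"
      by (rule emeasure_restr_to_subalg[OF sub in_vimage_algebra[OF D]])
    also have "\<dots> = emeasure (distr M M f) D"
      by (rule emeasure_distr[OF fM D, symmetric])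
    finally show "emeasure (distr ?G M f) D = emeasure (distr M M f) D" .
  qed simp
  then have "sigma_finite_measure (distr ?G M f)"
    using fin by (simp add: density_hRN[OF f, symmetric] sigma_finite_iff_density_finite)
  then show "sigma_finite_measure ?G"
    by (rule sigma_finite_measure_distr[OF _ fG])
qed

text \<open>Sets of the preimage algebra are preimages of measurable \<open>D\<close>. Changing
  variables multiplies the quotient by h, which leaves the integral of
  \<open>push_density M f g\<close> over \<open>D\<close>, that is, of \<open>g\<close> over the
  preimage.\<close>

lemma (in sigma_finite_measure) condE_eq_push_density:
  assumes f: "nonsingular M f" and fin: "AE x in M. hRN M f x < \<infinity>"
    and g[measurable]: "g \<in> borel_measurable M"
  shows "AE x in M. condE M f g x = push_density M f g (f x) / hRN M f (f x)"
proof -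
  let ?F = "vimage_algebra (space M) f M"
  have fM[measurable]: "f \<in> measurable M M" by (rule nonsingular_measurable[OF f])
  have fS: "f \<in> space M \<rightarrow> space M" using measurable_space[OF fM] by auto
  have "AE x in M. hRN M f x \<noteq> \<infinity>"
    using fin by eventually_elim simp
  then interpret F: sigma_finite_subalgebra M ?F
    by (rule sigma_finite_subalgebra_vimage[OF f])
  let ?u = "\<lambda>x. push_density M f g x / hRN M f x"
  have "AE x in M. ?u (f x) = nn_cond_exp M ?F g x"
  proof (rule F.nn_cond_exp_charact)
    show "(\<lambda>x. ?u (f x)) \<in> borel_measurable ?F"
      by (rule measurable_compose[OF measurable_vimage_algebra1]) (use fS in auto)
    fix A assume "A \<in> sets ?F"
    then obtain D where D[measurable]: "D \<in> sets M" and A: "A = f -` D \<inter> space M"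
      by (auto simp: sets_vimage_algebra2[OF fS])
    have "(\<integral>\<^sup>+x\<in>A. ?u (f x) \<partial>M) = (\<integral>\<^sup>+x. ?u (f x) * indicator D (f x) \<partial>M)"
      by (intro nn_integral_cong) (auto simp: A indicator_def)
    also have "\<dots> = (\<integral>\<^sup>+x. hRN M f x * (?u x * indicator D x) \<partial>M)"
      by (rule nn_integral_nonsingular[OF f, of "\<lambda>x. ?u x * indicator D x"]) measurable
    also have "\<dots> = (\<integral>\<^sup>+x\<in>D. push_density M f g x \<partial>M)"
    proof (rule nn_integral_cong_AE)
      show "AE x in M. hRN M f x * (?u x * indicator D x) = push_density M f g x * indicator D x"
        using fin push_density_eq_0[OF f g]
      proof eventually_elim
        case (elim x)
        then show ?case
          by (cases "hRN M f x = 0") (simp_all add: ennreal_times_divide_cancel flip: mult.assoc)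
      qed
    qed
    also have "\<dots> = (\<integral>\<^sup>+x\<in>A. g x \<partial>M)"
      unfolding A by (rule set_nn_integral_push_density[OF f g D])
    finally show "(\<integral>\<^sup>+x\<in>A. g x \<partial>M) = (\<integral>\<^sup>+x\<in>A. ?u (f x) \<partial>M)" by simp
  qed measurable
  then show ?thesis
    unfolding condE_def by eventually_elim simp
qed

text \<open>The quotient of densities meets the requirements in \<open>condE_inv\<close>, so the
  choice there is meaningful. The chosen function agrees with it on {h > 0}, as their compositions
  with \<open>f\<close> agree, and on {h = 0} it vanishes together with
  \<open>push_density M f g\<close>.\<close>

lemma (in sigma_finite_measure) hRN_times_condE_inv:
  assumes f: "nonsingular M f" and fin: "AE x in M. hRN M f x < \<infinity>"
    and g[measurable]: "g \<in> borel_measurable M"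
  shows "AE x in M. hRN M f x * condE_inv M f g x = push_density M f g x"
proof -
  let ?Q = "\<lambda>u. u \<in> borel_measurable M \<and> (AE x in M. hRN M f x = 0 \<longrightarrow> u x = 0) \<and>
       (AE x in M. condE M f g x = u (f x))"
  let ?u = "\<lambda>x. push_density M f g x / hRN M f x"
  \<comment> \<open>This is the division of \<open>ennreal\<close>, where 0 / 0 = 0, and not
    \<open>pdiv\<close>.\<close>
  have "AE x in M. hRN M f x = 0 \<longrightarrow> ?u x = 0"
    using push_density_eq_0[OF f g] by eventually_elim simp
  then have "?Q ?u"
    by (intro conjI condE_eq_push_density[OF f fin g]) measurable
  then have "?Q (condE_inv M f g)"
    unfolding condE_inv_def by (rule someI[where P = ?Q])
  then have [measurable]: "condE_inv M f g \<in> borel_measurable M"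
    and z: "AE x in M. hRN M f x = 0 \<longrightarrow> condE_inv M f g x = 0"
    and e: "AE x in M. condE M f g x = condE_inv M f g (f x)"
    by auto
  have "AE x in M. condE_inv M f g (f x) = ?u (f x)"
    using e condE_eq_push_density[OF f fin g] by eventually_elim simp
  then have "AE x in M. 0 < hRN M f x \<longrightarrow> condE_inv M f g x = ?u x"
    by (subst (asm) AE_nonsingular_iff[OF f, of "\<lambda>x. condE_inv M f g x = ?u x"]) measurable
  with z push_density_eq_0[OF f g] fin show ?thesis
  proof eventually_elim
    case (elim x)
    then show ?case
      by (cases "hRN M f x = 0")
         (simp_all add: ennreal_times_divide_cancel zero_less_iff_neq_zero)
  qed
qed

text \<open>Both sides of the formula are functions of f(x), so the equation descends to {h > 0},
  where the finite factor h cancels.\<close>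

lemma (in sigma_finite_measure) condE_eq_pdiv_iff:
  assumes f: "nonsingular M f" and fin: "AE x in M. hRN M f x < \<infinity>"
    and g[measurable]: "g \<in> borel_measurable M" and [measurable]: "J \<in> borel_measurable M"
  shows "(AE x in M. condE M f g x = pdiv (J (f x)) (hRN M f (f x))) \<longleftrightarrow>
    (AE x in M. 0 < hRN M f x \<longrightarrow> push_density M f g x = J x)"
proof -
  have "(AE x in M. condE M f g x = pdiv (J (f x)) (hRN M f (f x))) \<longleftrightarrow>
      (AE x in M. push_density M f g (f x) / hRN M f (f x) = pdiv (J (f x)) (hRN M f (f x)))"
  proof
    assume "AE x in M. condE M f g x = pdiv (J (f x)) (hRN M f (f x))"
    with condE_eq_push_density[OF f fin g]
    show "AE x in M. push_density M f g (f x) / hRN M f (f x) = pdiv (J (f x)) (hRN M f (f x))"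
      by eventually_elim simp
  next
    assume "AE x in M. push_density M f g (f x) / hRN M f (f x) = pdiv (J (f x)) (hRN M f (f x))"
    with condE_eq_push_density[OF f fin g]
    show "AE x in M. condE M f g x = pdiv (J (f x)) (hRN M f (f x))"
      by eventually_elim simp
  qed
  also have "\<dots> \<longleftrightarrow> (AE x in M. 0 < hRN M f x \<longrightarrow>
      push_density M f g x / hRN M f x = pdiv (J x) (hRN M f x))"
    by (rule AE_nonsingular_iff[OF f, of "\<lambda>x. push_density M f g x / hRN M f x = pdiv (J x) (hRN M f x)"])
       measurable
  also have "\<dots> \<longleftrightarrow> (AE x in M. 0 < hRN M f x \<longrightarrow> push_density M f g x = J x)"
  proof (rule iffI)
    assume "AE x in M. 0 < hRN M f x \<longrightarrow> push_density M f g x / hRN M f x = pdiv (J x) (hRN M f x)"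
    with fin show "AE x in M. 0 < hRN M f x \<longrightarrow> push_density M f g x = J x"
      by eventually_elim (auto simp: pdiv_pos ennreal_divide_right_cancel)
  next
    assume "AE x in M. 0 < hRN M f x \<longrightarrow> push_density M f g x = J x"
    then show "AE x in M. 0 < hRN M f x \<longrightarrow> push_density M f g x / hRN M f x = pdiv (J x) (hRN M f x)"
      by eventually_elim (auto simp: pdiv_pos)
  qed
  finally show ?thesis .
qed

subsection \<open>The measure of a family of probability measures\<close>

text \<open>The measure with density \<open>h\<close> is \<sigma>-finite, and the cylinders over a
  cover by sets of finite measure have finite \<open>L\<close>-measure. This serves \<rho> with h =
  1, and its image under \<Phi> with the density of \<open>f\<close>.\<close>

lemma countable_cover_rectangles:
  fixes h :: "'a \<Rightarrow> ennreal"
  assumes "sigma_finite_measure M" "h \<in> borel_measurable M" "AE x in M. h x \<noteq> \<infinity>"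
    and L: "\<And>D. D \<in> sets M \<Longrightarrow> emeasure L (D \<times> space N) = (\<integral>\<^sup>+x\<in>D. h x \<partial>M)"
  obtains A :: "nat \<Rightarrow> 'a set" where "range A \<subseteq> sets M" "(\<Union>i. A i) = space M"
    "\<And>i. emeasure L (A i \<times> space N) \<noteq> \<infinity>"
proof -
  interpret M: sigma_finite_measure M by fact
  interpret H: sigma_finite_measure "density M h"
    using assms(2,3) by (simp add: M.sigma_finite_iff_density_finite)
  obtain A :: "nat \<Rightarrow> 'a set" where "range A \<subseteq> sets (density M h)" "(\<Union>i. A i) = space (density M h)"
    "\<And>i. emeasure (density M h) (A i) \<noteq> \<infinity>"
    using H.sigma_finite by blast
  with that[of A] L assms(2) show thesis
    by (auto simp: emeasure_density subset_eq)
qed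

text \<open>Rectangles form an intersection-stable generator, and the covering cylinders supply the
  finite sets for uniqueness. Only \<open>L\<close> has to be controlled on cylinders.\<close>

lemma measure_eqI_rectangles:
  fixes h :: "'a \<Rightarrow> ennreal"
  assumes "sigma_finite_measure M" "h \<in> borel_measurable M" "AE x in M. h x \<noteq> \<infinity>"
    and L: "\<And>D. D \<in> sets M \<Longrightarrow> emeasure L (D \<times> space N) = (\<integral>\<^sup>+x\<in>D. h x \<partial>M)"
    and sets: "sets L = sets (M \<Otimes>\<^sub>M N)" "sets L' = sets (M \<Otimes>\<^sub>M N)"
    and eq: "\<And>D S. D \<in> sets M \<Longrightarrow> S \<in> sets N \<Longrightarrow> emeasure L (D \<times> S) = emeasure L' (D \<times> S)"
  shows "L = L'"
proof -
  obtain A :: "nat \<Rightarrow> 'a set" where A: "range A \<subseteq> sets M" "(\<Union>i. A i) = space M"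
    "\<And>i. emeasure L (A i \<times> space N) \<noteq> \<infinity>"
    using countable_cover_rectangles[OF assms(1-4)] by metis
  show ?thesis
  proof (rule measure_eqI_generator_eq[where A = "\<lambda>i. A i \<times> space N"])
    show "Int_stable {a \<times> b |a b. a \<in> sets M \<and> b \<in> sets N}"
      by (rule Int_stable_pair_measure_generator)
    show "range (\<lambda>i. A i \<times> space N) \<subseteq> {a \<times> b |a b. a \<in> sets M \<and> b \<in> sets N}"
      using A(1) by blast
    show "(\<Union>i. A i \<times> space N) = space M \<times> space N"
      using A(2) by blast
    show "{a \<times> b |a b. a \<in> sets M \<and> b \<in> sets N} \<subseteq> Pow (space M \<times> space N)"
      by (rule pair_measure_closed)
  qed (use A(3) sets eq in \<open>auto simp: sets_pair_measure\<close>)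
qed

lemma sigma_finite_rectangles:
  fixes h :: "'a \<Rightarrow> ennreal"
  assumes "sigma_finite_measure M" "h \<in> borel_measurable M" "AE x in M. h x \<noteq> \<infinity>"
    and L: "\<And>D. D \<in> sets M \<Longrightarrow> emeasure L (D \<times> space N) = (\<integral>\<^sup>+x\<in>D. h x \<partial>M)"
    and sets: "sets L = sets (M \<Otimes>\<^sub>M N)"
  shows "sigma_finite_measure L"
proof
  obtain A :: "nat \<Rightarrow> 'a set" where A: "range A \<subseteq> sets M" "(\<Union>i. A i) = space M"
    "\<And>i. emeasure L (A i \<times> space N) \<noteq> \<infinity>"
    using countable_cover_rectangles[OF assms(1-4)] by metis
  have "space L = space M \<times> space N"
    using sets_eq_imp_space_eq[OF sets] by (simp add: space_pair_measure)
  then show "\<exists>B. countable B \<and> B \<subseteq> sets L \<and> \<Union>B = space L \<and> (\<forall>b\<in>B. emeasure L b \<noteq> \<infinity>)"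
    using A sets by (intro exI[of _ "range (\<lambda>i. A i \<times> space N)"]) auto
qed

section \<open>The measure \<rho> and integration against it\<close>

locale prob_family_measure = sigma_finite_measure M
  for M :: "'a measure" and N :: "'t measure" and P :: "'a \<Rightarrow> 't measure" +
  assumes P: "prob_family M N P"
begin

abbreviation "R \<equiv> rho M N P"

lemma prob_space_P: "x \<in> space M \<Longrightarrow> prob_space (P x)"
  and sets_P: "x \<in> space M \<Longrightarrow> sets (P x) = sets N"
  using P by (auto simp: prob_family_def)

lemma space_P: "x \<in> space M \<Longrightarrow> space (P x) = space N"
  by (rule sets_eq_imp_space_eq[OF sets_P])

lemma emeasure_P_space: "x \<in> space M \<Longrightarrow> emeasure (P x) (space N) = 1"
  using prob_space.emeasure_space_1[OF prob_space_P[of x]] by (simp add: space_P)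

lemma kernel_P[measurable]: "P \<in> measurable M (subprob_algebra N)"
proof (rule measurable_subprob_algebra)
  fix S assume "S \<in> sets N"
  then have "(\<lambda>x. ennreal (measure (P x) S)) \<in> borel_measurable M"
    using P by (auto simp: prob_family_def)
  also have "?this \<longleftrightarrow> (\<lambda>x. emeasure (P x) S) \<in> borel_measurable M"
    by (intro measurable_cong finite_measure.emeasure_eq_measure[symmetric] prob_space.finite_measure prob_space_P)
  finally show "(\<lambda>x. emeasure (P x) S) \<in> borel_measurable M" .
qed (auto simp: sets_P intro: prob_space_imp_subprob_space prob_space_P)

lemma nn_integral_P_measurable:
  "G \<in> borel_measurable (M \<Otimes>\<^sub>M N) \<Longrightarrow> (\<lambda>x. \<integral>\<^sup>+t. G (x, t) \<partial>P x) \<in> borel_measurable M"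
  using nn_integral_measurable_subprob_algebra2[of "\<lambda>x t. G (x, t)" M N P] by simp

text \<open>An explicit form of \<rho>, obtained by integrating the kernel over \<open>M\<close>.
  The empty space is treated separately because \<open>bind\<close> takes a default value
  there.\<close>

definition joint :: "('a \<times> 't) measure" where
  "joint = (if space M = {} then null_measure (M \<Otimes>\<^sub>M N)
     else M \<bind> (\<lambda>x. distr (P x) (M \<Otimes>\<^sub>M N) (Pair x)))"

lemma sets_joint: "sets joint = sets (M \<Otimes>\<^sub>M N)"
  by (simp add: joint_def sets_bind[where N = "M \<Otimes>\<^sub>M N"])

lemma nn_integral_joint:
  assumes [measurable]: "G \<in> borel_measurable (M \<Otimes>\<^sub>M N)"
  shows "(\<integral>\<^sup>+p. G p \<partial>joint) = (\<integral>\<^sup>+x. \<integral>\<^sup>+t. G (x, t) \<partial>P x \<partial>M)"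
proof (cases "space M = {}")
  case True
  then show ?thesis
    by (simp add: joint_def nn_integral_empty space_pair_measure)
next
  case False
  have "(\<lambda>x. distr (P x) (M \<Otimes>\<^sub>M N) (Pair x)) \<in> measurable M (subprob_algebra (M \<Otimes>\<^sub>M N))"
    by (rule measurable_distr2[OF _ kernel_P]) simp
  then have "(\<integral>\<^sup>+p. G p \<partial>joint) = (\<integral>\<^sup>+x. \<integral>\<^sup>+p. G p \<partial>distr (P x) (M \<Otimes>\<^sub>M N) (Pair x) \<partial>M)"
    using False by (simp add: joint_def nn_integral_bind[where B = "M \<Otimes>\<^sub>M N"])
  also have "\<dots> = (\<integral>\<^sup>+x. \<integral>\<^sup>+t. G (x, t) \<partial>P x \<partial>M)"
  proof (rule nn_integral_cong)
    fix x assume x: "x \<in> space M"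
    note sets_P[OF x, measurable_cong]
    show "(\<integral>\<^sup>+p. G p \<partial>distr (P x) (M \<Otimes>\<^sub>M N) (Pair x)) = (\<integral>\<^sup>+t. G (x, t) \<partial>P x)"
      using x by (intro nn_integral_distr) measurable
  qed
  finally show ?thesis .
qed

lemma emeasure_joint:
  assumes [measurable]: "D \<in> sets M" "S \<in> sets N"
  shows "emeasure joint (D \<times> S) = (\<integral>\<^sup>+x\<in>D. emeasure (P x) S \<partial>M)"
proof -
  have "emeasure joint (D \<times> S) = (\<integral>\<^sup>+p. indicator (D \<times> S) p \<partial>joint)"
    by (simp add: sets_joint)
  also have "\<dots> = (\<integral>\<^sup>+x. \<integral>\<^sup>+t. indicator (D \<times> S) (x, t) \<partial>P x \<partial>M)"
    by (rule nn_integral_joint) measurable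
  also have "\<dots> = (\<integral>\<^sup>+x\<in>D. emeasure (P x) S \<partial>M)"
    using assms by (intro nn_integral_cong) (simp add: indicator_times sets_P nn_integral_cmult mult.commute)
  finally show ?thesis .
qed

lemma set_nn_integral_P_space:
  assumes "D \<in> sets M"
  shows "(\<integral>\<^sup>+x\<in>D. emeasure (P x) (space N) \<partial>M) = emeasure M D"
proof -
  have "(\<integral>\<^sup>+x\<in>D. emeasure (P x) (space N) \<partial>M) = (\<integral>\<^sup>+x\<in>D. 1 \<partial>M)"
    by (rule nn_integral_cong) (simp add: emeasure_P_space)
  with assms show ?thesis by simp
qed

text \<open>Existence is given by \<open>joint\<close>. Uniqueness holds because a cylinder has the
  measure of its base and \<open>M\<close> is \<sigma>-finite, so the choice in \<open>rho\<close>
  has one possible value.\<close>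

lemma rho_eq_joint: "R = joint"
  unfolding rho_def
proof (rule some_equality)
  show "sets joint = sets (M \<Otimes>\<^sub>M N) \<and>
    (\<forall>D\<in>sets M. \<forall>S\<in>sets N. emeasure joint (D \<times> S) = (\<integral>\<^sup>+x\<in>D. emeasure (P x) S \<partial>M))"
    by (simp add: sets_joint emeasure_joint)
  fix r assume r: "sets r = sets (M \<Otimes>\<^sub>M N) \<and>
    (\<forall>D\<in>sets M. \<forall>S\<in>sets N. emeasure r (D \<times> S) = (\<integral>\<^sup>+x\<in>D. emeasure (P x) S \<partial>M))"
  show "r = joint"
  proof (rule measure_eqI_rectangles[OF sigma_finite_measure_axioms, where h = "\<lambda>_. 1"])
    fix D assume "D \<in> sets M"
    with r show "emeasure r (D \<times> space N) = (\<integral>\<^sup>+x\<in>D. 1 \<partial>M)"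
      by (simp add: set_nn_integral_P_space)
  qed (use r in \<open>simp_all add: sets_joint emeasure_joint\<close>)
qed

lemma sets_rho[measurable_cong]: "sets R = sets (M \<Otimes>\<^sub>M N)"
  by (simp add: rho_eq_joint sets_joint)

lemma space_rho: "space R = space M \<times> space N"
  using sets_eq_imp_space_eq[OF sets_rho] by (simp add: space_pair_measure)

lemmas nn_integral_rho = nn_integral_joint[folded rho_eq_joint]
  and emeasure_rho = emeasure_joint[folded rho_eq_joint]

lemma emeasure_rho_cylinder:
  "D \<in> sets M \<Longrightarrow> emeasure R (D \<times> space N) = emeasure M D"
  by (simp add: emeasure_rho set_nn_integral_P_space)

sublocale R: sigma_finite_measure R
  by (rule sigma_finite_rectangles[OF sigma_finite_measure_axioms, where h = "\<lambda>_. 1"])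
     (auto simp: emeasure_rho_cylinder sets_rho)

lemma emeasure_density_rho:
  assumes [measurable]: "G \<in> borel_measurable (M \<Otimes>\<^sub>M N)" "D \<in> sets M" "S \<in> sets N"
  shows "emeasure (density R G) (D \<times> S) = (\<integral>\<^sup>+x\<in>D. (\<integral>\<^sup>+t\<in>S. G (x, t) \<partial>P x) \<partial>M)"
proof -
  have "emeasure (density R G) (D \<times> S) = (\<integral>\<^sup>+p. G p * indicator (D \<times> S) p \<partial>R)"
    by (rule emeasure_density) measurable
  also have "\<dots> = (\<integral>\<^sup>+x. \<integral>\<^sup>+t. G (x, t) * indicator (D \<times> S) (x, t) \<partial>P x \<partial>M)"
    by (rule nn_integral_rho) measurable
  also have "\<dots> = (\<integral>\<^sup>+x\<in>D. (\<integral>\<^sup>+t\<in>S. G (x, t) \<partial>P x) \<partial>M)"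
    by (intro nn_integral_cong) (simp add: indicator_def)
  finally show ?thesis .
qed

end

subsection \<open>The product transformation\<close>

locale family_transformation = prob_family_measure M N P
  for M :: "'a measure" and N :: "'t measure" and P :: "'a \<Rightarrow> 't measure" +
  fixes f :: "'a \<Rightarrow> 'a"
  assumes f: "nonsingular M f" and h_finite: "AE x in M. hRN M f x < \<infinity>"
begin

abbreviation "h \<equiv> hRN M f"
abbreviation "\<Phi> \<equiv> PhiMap f :: 'a \<times> 't \<Rightarrow> 'a \<times> 't"
abbreviation "H \<equiv> hRN R \<Phi>"
abbreviation "W S \<equiv> push_density M f (\<lambda>x. emeasure (P x) S)"

lemma f_measurable[measurable]: "f \<in> measurable M M"
  by (rule nonsingular_measurable[OF f])

lemma h_not_top: "AE x in M. h x \<noteq> \<infinity>"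
  using h_finite by eventually_elim simp

lemma Phi_measurable_pair[measurable]: "\<Phi> \<in> measurable (M \<Otimes>\<^sub>M N) (M \<Otimes>\<^sub>M N)"
  unfolding PhiMap_def by measurable

lemma Phi_measurable[measurable]: "\<Phi> \<in> measurable R R"
  by measurable

lemma H_measurable[measurable]: "H \<in> borel_measurable (M \<Otimes>\<^sub>M N)"
  using hRN_measurable[of R \<Phi>] by (simp add: measurable_cong_sets[OF sets_rho refl])

text \<open>\<Phi> leaves the second coordinate alone, so the preimage of a rectangle is again a
  rectangle with the same second side.\<close>

lemma emeasure_distr_Phi:
  assumes [measurable]: "D \<in> sets M" "S \<in> sets N"
  shows "emeasure (distr R R \<Phi>) (D \<times> S) = (\<integral>\<^sup>+x\<in>D. W S x \<partial>M)"
proof -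
  have "\<Phi> -` (D \<times> S) \<inter> space R = (f -` D \<inter> space M) \<times> S"
    using sets.sets_into_space[OF assms(2)] by (auto simp: PhiMap_def space_rho)
  then have "emeasure (distr R R \<Phi>) (D \<times> S) = emeasure R ((f -` D \<inter> space M) \<times> S)"
    by (simp add: emeasure_distr sets_rho)
  also have "\<dots> = (\<integral>\<^sup>+x\<in>f -` D \<inter> space M. emeasure (P x) S \<partial>M)"
    by (rule emeasure_rho) measurable
  also have "\<dots> = (\<integral>\<^sup>+x\<in>D. W S x \<partial>M)"
    by (rule set_nn_integral_push_density[OF f, symmetric]) measurable
  finally show ?thesis .
qed

lemma emeasure_distr_Phi_cylinder:
  assumes [measurable]: "D \<in> sets M"
  shows "emeasure (distr R R \<Phi>) (D \<times> space N) = (\<integral>\<^sup>+x\<in>D. h x \<partial>M)"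
proof -
  have "\<Phi> -` (D \<times> space N) \<inter> space R = (f -` D \<inter> space M) \<times> space N"
    by (auto simp: PhiMap_def space_rho)
  then have "emeasure (distr R R \<Phi>) (D \<times> space N) = emeasure (distr M M f) D"
    by (simp add: emeasure_distr sets_rho emeasure_rho_cylinder)
  also have "\<dots> = (\<integral>\<^sup>+x\<in>D. h x \<partial>M)"
    by (simp add: density_hRN[OF f, symmetric] emeasure_density)
  finally show ?thesis .
qed

text \<open>For fixed \<open>S\<close> both measures, as functions of \<open>D\<close>, have
  densities with respect to \<open>M\<close>, which are unique almost everywhere. The exceptional
  set may depend on \<open>S\<close>, since agreement on rectangles is enough.\<close>

lemma distr_Phi_eq_density_iff:
  assumes G[measurable]: "G \<in> borel_measurable (M \<Otimes>\<^sub>M N)"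
  shows "distr R R \<Phi> = density R G \<longleftrightarrow>
    (\<forall>S\<in>sets N. AE x in M. W S x = (\<integral>\<^sup>+t\<in>S. G (x, t) \<partial>P x))"
proof
  assume eq: "distr R R \<Phi> = density R G"
  show "\<forall>S\<in>sets N. AE x in M. W S x = (\<integral>\<^sup>+t\<in>S. G (x, t) \<partial>P x)"
  proof
    fix S assume [measurable]: "S \<in> sets N"
    let ?J = "\<lambda>x. \<integral>\<^sup>+t\<in>S. G (x, t) \<partial>P x"
    have "(\<lambda>x. \<integral>\<^sup>+t. (\<lambda>p. G p * indicator S (snd p)) (x, t) \<partial>P x) \<in> borel_measurable M"
      by (rule nn_integral_P_measurable) measurable
    then have [measurable]: "?J \<in> borel_measurable M" by simp
    have "density M (W S) = density M ?J"
    proof (rule measure_eqI)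
      fix D assume "D \<in> sets (density M (W S))"
      then have [measurable]: "D \<in> sets M" by simp
      have "emeasure (density M (W S)) D = emeasure (distr R R \<Phi>) (D \<times> S)"
        by (simp add: emeasure_distr_Phi emeasure_density)
      also have "\<dots> = emeasure (density M ?J) D"
        unfolding eq by (subst emeasure_density_rho) (simp_all add: emeasure_density)
      finally show "emeasure (density M (W S)) D = emeasure (density M ?J) D" .
    qed simp
    then show "AE x in M. W S x = ?J x"
      by (intro density_unique) auto
  qed
next
  assume W: "\<forall>S\<in>sets N. AE x in M. W S x = (\<integral>\<^sup>+t\<in>S. G (x, t) \<partial>P x)"
  show "distr R R \<Phi> = density R G"
  \<comment> \<open>Finiteness of h controls the image measure on cylinders; no such control of
    \<open>density R G\<close> is available beforehand.\<close>
  proof (rule measure_eqI_rectangles[OF sigma_finite_measure_axioms hRN_measurable h_not_top])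
    fix D S assume D[measurable]: "D \<in> sets M" and S[measurable]: "S \<in> sets N"
    have "(\<integral>\<^sup>+x\<in>D. W S x \<partial>M) = (\<integral>\<^sup>+x\<in>D. (\<integral>\<^sup>+t\<in>S. G (x, t) \<partial>P x) \<partial>M)"
      by (rule nn_integral_cong_AE) (use W[rule_format, OF S] in eventually_elim, simp)
    then show "emeasure (distr R R \<Phi>) (D \<times> S) = emeasure (density R G) (D \<times> S)"
      by (simp only: emeasure_distr_Phi[OF D S] emeasure_density_rho[OF G D S])
  qed (auto simp: sets_rho emeasure_distr_Phi_cylinder)
qed

text \<open>On cylinders the image of \<rho> is given by the finite density h, so it is
  \<sigma>-finite, and this amounts to finiteness of its density.\<close>

lemma H_finite:
  assumes "nonsingular R \<Phi>"
  shows "AE p in R. H p \<noteq> \<infinity>"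
proof -
  have "sigma_finite_measure (distr R R \<Phi>)"
    by (rule sigma_finite_rectangles[OF sigma_finite_measure_axioms hRN_measurable h_not_top])
       (auto simp: sets_rho emeasure_distr_Phi_cylinder)
  then show ?thesis
    by (simp add: R.density_hRN[OF assms, symmetric] R.sigma_finite_iff_density_finite)
qed

text \<open>The cylinder over {h = 0} has image measure 0, so \<open>H\<close> integrates to 0 over
  it. Positivity of \<open>H\<close> makes the cylinder null, and with it the base.\<close>

lemma h_pos_of_H_pos:
  assumes ns: "nonsingular R \<Phi>" and H: "AE p in R. 0 < H p"
  shows "AE x in M. 0 < h x"
proof -
  let ?D = "{x \<in> space M. h x = 0}"
  have "(\<integral>\<^sup>+p. H p * indicator (?D \<times> space N) p \<partial>R) = emeasure (distr R R \<Phi>) (?D \<times> space N)"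
    by (simp add: R.density_hRN[OF ns, symmetric] emeasure_density sets_rho)
  also have "\<dots> = (\<integral>\<^sup>+x\<in>?D. h x \<partial>M)"
    by (rule emeasure_distr_Phi_cylinder) measurable
  also have "\<dots> = (\<integral>\<^sup>+x. 0 \<partial>M)"
    by (rule nn_integral_cong) (simp add: indicator_def)
  finally have "AE p in R. H p * indicator (?D \<times> space N) p = 0"
    by (subst nn_integral_0_iff_AE[symmetric]) (auto simp: sets_rho)
  with H have "AE p in R. p \<notin> ?D \<times> space N"
    by eventually_elim (auto simp: indicator_def split: if_splits)
  then have "emeasure R (?D \<times> space N) = 0"
    by (subst (asm) AE_iff_null_sets[symmetric]) (auto simp: sets_rho null_sets_def)
  then have "emeasure M ?D = 0"
    by (simp add: emeasure_rho_cylinder)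
  then have "AE x in M. x \<notin> ?D"
    by (subst AE_iff_measurable[OF _ refl]) (auto simp: space_rho)
  with AE_space show ?thesis
    by eventually_elim (auto simp: zero_less_iff_neq_zero)
qed

section \<open>The six conditions for a fixed measurable \<open>z\<close>\<close>

context
  fixes z :: "'t \<Rightarrow> ennreal"
  assumes z[measurable]: "z \<in> borel_measurable N"
begin

abbreviation "J S x \<equiv> \<integral>\<^sup>+t\<in>S. z t \<partial>P x"

lemma J_measurable[measurable]:
  assumes [measurable]: "S \<in> sets N"
  shows "J S \<in> borel_measurable M"
proof -
  have "(\<lambda>x. \<integral>\<^sup>+t. (\<lambda>p. z (snd p) * indicator S (snd p)) (x, t) \<partial>P x) \<in> borel_measurable M"
    by (rule nn_integral_P_measurable) measurable
  then show ?thesis by simp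
qed

text \<open>What happens on {h = 0} stays open here; the additional clauses of (i), (ii) and (iii)
  close this gap.\<close>

lemma CC_iff: "CC M N P f z \<longleftrightarrow> (\<forall>S\<in>sets N. AE x in M. 0 < h x \<longrightarrow> W S x = J S x)"
  unfolding CC_def
  by (intro ball_cong refl condE_eq_pdiv_iff[OF f h_finite]) auto

lemma cond_iv_iff: "cond_iv M N P f z \<longleftrightarrow> (\<forall>S\<in>sets N. AE x in M. W S x = J S x)"
  unfolding cond_iv_def
proof (intro ball_cong refl)
  fix S assume [measurable]: "S \<in> sets N"
  have *: "AE x in M. h x * condE_inv M f (\<lambda>y. emeasure (P y) S) x = W S x"
    by (rule hRN_times_condE_inv[OF f h_finite]) measurable
  show "(AE x in M. h x * condE_inv M f (\<lambda>y. emeasure (P y) S) x = J S x) \<longleftrightarrow> (AE x in M. W S x = J S x)"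
    (is "?L \<longleftrightarrow> ?R")
  proof
    assume ?L with * show ?R by eventually_elim simp
  next
    assume ?R with * show ?L by eventually_elim simp
  qed
qed

text \<open>Densities with respect to the \<sigma>-finite measure \<rho> are unique, and the
  equation of measures implies nonsingularity.\<close>

lemma cond_v_iff: "cond_v M N P f z \<longleftrightarrow> distr R R \<Phi> = density R (\<lambda>p. z (snd p))"
proof
  assume v: "cond_v M N P f z"
  then have "density R H = density R (\<lambda>p. z (snd p))"
    by (intro density_cong) (auto simp: cond_v_def)
  with v show "distr R R \<Phi> = density R (\<lambda>p. z (snd p))"
    by (simp add: R.density_hRN cond_v_def)
next
  assume eq: "distr R R \<Phi> = density R (\<lambda>p. z (snd p))"
  then have ns: "nonsingular R \<Phi>"
    by (intro nonsingular_of_density[where g = "\<lambda>p. z (snd p)"]) measurable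
  have "AE p in R. H p = z (snd p)"
    by (rule R.density_unique) (auto simp: R.density_hRN[OF ns] eq)
  with ns show "cond_v M N P f z" by (simp add: cond_v_def)
qed

lemma cond_v_iff_iv: "cond_v M N P f z \<longleftrightarrow> cond_iv M N P f z"
  unfolding cond_v_iff cond_iv_iff
  by (subst distr_Phi_eq_density_iff) auto

text \<open>The cylinder over \<open>{z = 0}\<close> is its own preimage under \<open>\<Phi>\<close>, so its measure is the integral of
  \<open>z\<close> over it.\<close>
lemma z_bounds:
  assumes v: "cond_v M N P f z"
  shows "AE p in R. 0 < z (snd p) \<and> z (snd p) < \<infinity>"
proof -
  from v have ns: "nonsingular R \<Phi>" and H: "AE p in R. H p = z (snd p)"
    by (auto simp: cond_v_def)
  let ?Z = "space M \<times> {t \<in> space N. z t = 0}"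
  have [measurable]: "?Z \<in> sets R" by measurable
  have "\<Phi> -` ?Z \<inter> space R = ?Z"
    using measurable_space[OF f_measurable] by (auto simp: PhiMap_def space_rho)
  then have "emeasure R ?Z = emeasure (distr R R \<Phi>) ?Z"
    by (simp add: emeasure_distr)
  also have "\<dots> = (\<integral>\<^sup>+p. z (snd p) * indicator ?Z p \<partial>R)"
    using v by (simp add: cond_v_iff emeasure_density)
  also have "\<dots> = (\<integral>\<^sup>+p. 0 \<partial>R)"
    by (intro nn_integral_cong) (auto simp: indicator_def)
  finally have "AE p in R. p \<notin> ?Z"
    by (intro AE_not_in) (simp add: null_sets_def)
  \<comment> \<open>The upper bound for \<open>z\<close> is inherited from \<open>H\<close>.\<close>
  with AE_space H H_finite[OF ns] show ?thesis
    by eventually_elim (auto simp: space_rho zero_less_iff_neq_zero less_top[symmetric])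
qed

lemma h_pos:
  assumes v: "cond_v M N P f z"
  shows "AE x in M. 0 < h x"
proof (rule h_pos_of_H_pos)
  show "nonsingular R \<Phi>" using v by (simp add: cond_v_def)
  have "AE p in R. H p = z (snd p)" using v by (simp add: cond_v_def)
  with z_bounds[OF v] show "AE p in R. 0 < H p" by eventually_elim simp
qed

lemma W_null: "S \<in> sets N \<Longrightarrow> AE x in M. h x = 0 \<longrightarrow> W S x = 0"
  by (rule push_density_eq_0[OF f]) measurable

text \<open>From (iv), positivity of h is obtained by way of (v) and \<open>h_pos\<close>; once h >
  0, (CC) and (iv) say the same.\<close>

lemma cond_i_iff_iv: "cond_i M N P f z \<longleftrightarrow> cond_iv M N P f z"
proof
  assume i: "cond_i M N P f z"
  show "cond_iv M N P f z"
    unfolding cond_iv_iff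
  proof
    fix S assume "S \<in> sets N"
    with i have "AE x in M. 0 < h x \<longrightarrow> W S x = J S x" "AE x in M. 0 < h x"
      by (auto simp: cond_i_def CC_iff)
    then show "AE x in M. W S x = J S x" by eventually_elim simp
  qed
next
  assume iv: "cond_iv M N P f z"
  then have "AE x in M. 0 < h x" by (intro h_pos) (simp add: cond_v_iff_iv)
  moreover have "CC M N P f z"
    unfolding CC_iff
  proof
    fix S assume "S \<in> sets N"
    with iv have "AE x in M. W S x = J S x" by (simp add: cond_iv_iff)
    then show "AE x in M. 0 < h x \<longrightarrow> W S x = J S x" by eventually_elim simp
  qed
  ultimately show "cond_i M N P f z" by (simp add: cond_i_def)
qed

text \<open>On {h = 0} the density \<open>W S\<close> vanishes, and \<open>J S\<close> is dominated
  by the integral of \<open>z\<close> over the whole space, which (ii) makes 0 there.\<close>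

lemma cond_ii_iff_iv: "cond_ii M N P f z \<longleftrightarrow> cond_iv M N P f z"
proof
  assume ii: "cond_ii M N P f z"
  show "cond_iv M N P f z"
    unfolding cond_iv_iff
  proof
    fix S assume S: "S \<in> sets N"
    with ii have "AE x in M. 0 < h x \<longrightarrow> W S x = J S x" "AE x in M. h x = 0 \<longrightarrow> (\<integral>\<^sup>+t. z t \<partial>P x) = 0"
      by (auto simp: cond_ii_def CC_iff)
    with W_null[OF S] show "AE x in M. W S x = J S x"
    proof eventually_elim
      case (elim x)
      have "J S x \<le> (\<integral>\<^sup>+t. z t \<partial>P x)"
        by (intro nn_integral_mono) (auto simp: indicator_def)
      with elim show ?case by (cases "h x = 0") (auto simp: zero_less_iff_neq_zero)
    qed
  qed
next
  assume "cond_iv M N P f z"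
  then have "CC M N P f z" and "AE x in M. 0 < h x"
    by (simp_all add: cond_i_iff_iv[symmetric] cond_i_def)
  moreover from this(2) have "AE x in M. h x = 0 \<longrightarrow> (\<integral>\<^sup>+t. z t \<partial>P x) = 0"
    by eventually_elim simp
  ultimately show "cond_ii M N P f z" by (simp add: cond_ii_def)
qed

text \<open>For nonsingular \<Phi>, \<open>W S\<close> is the integral of \<open>H\<close> over
  \<open>S\<close>. Condition (vi) compares \<open>H\<close> with \<open>z\<close> along
  \<open>f\<close>, that is on {h > 0}, and positivity of h extends this to almost every
  point.\<close>

lemma cond_vi_iff_v: "cond_vi M N P f z \<longleftrightarrow> cond_v M N P f z"
proof
  assume vi: "cond_vi M N P f z"
  then have ns: "nonsingular R \<Phi>" and h: "AE x in M. 0 < h x" by (auto simp: cond_vi_def)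
  have "AE x in M. W S x = J S x" if S[measurable]: "S \<in> sets N" for S
  proof -
    let ?G = "\<lambda>x. \<integral>\<^sup>+t\<in>S. H (x, t) \<partial>P x"
    have "(\<lambda>x. \<integral>\<^sup>+t. (\<lambda>p. H p * indicator S (snd p)) (x, t) \<partial>P x) \<in> borel_measurable M"
      by (rule nn_integral_P_measurable) measurable
    then have [measurable]: "?G \<in> borel_measurable M" by simp
    have "AE x in M. ?G (f x) = J S (f x)"
      using vi S by (auto simp: cond_vi_def)
    then have "AE x in M. 0 < h x \<longrightarrow> ?G x = J S x"
      by (subst (asm) AE_nonsingular_iff[OF f, of "\<lambda>x. ?G x = J S x"]) measurable
    moreover have "AE x in M. W S x = ?G x"
      using distr_Phi_eq_density_iff[OF H_measurable] S by (simp add: R.density_hRN[OF ns])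
    ultimately show ?thesis using h by eventually_elim simp
  qed
  then show "cond_v M N P f z" by (simp add: cond_v_iff_iv cond_iv_iff)
next
  assume v: "cond_v M N P f z"
  then have ns: "nonsingular R \<Phi>" by (simp add: cond_v_def)
  have "AE x in M. (\<integral>\<^sup>+t\<in>S. H (f x, t) \<partial>P (f x)) = J S (f x)" if S: "S \<in> sets N" for S
  proof (rule AE_nonsingular[OF f])
    have "AE x in M. W S x = (\<integral>\<^sup>+t\<in>S. H (x, t) \<partial>P x)"
      using distr_Phi_eq_density_iff[OF H_measurable] S by (simp add: R.density_hRN[OF ns])
    moreover have "AE x in M. W S x = J S x"
      using v S by (simp add: cond_v_iff_iv cond_iv_iff)
    ultimately show "AE x in M. (\<integral>\<^sup>+t\<in>S. H (x, t) \<partial>P x) = J S x"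
      by eventually_elim simp
  qed
  with ns h_pos[OF v] show "cond_vi M N P f z" by (simp add: cond_vi_def)
qed

lemma quasinormal_of_cond_v:
  assumes v: "cond_v M N P f z"
  shows "quasinormal R (comp_op R \<Phi>)"
proof -
  from v have ns: "nonsingular R \<Phi>" and H: "AE p in R. H p = z (snd p)"
    by (auto simp: cond_v_def)
  \<comment> \<open>The value 1 on the null set where \<open>z\<close> is 0 or infinite makes
    \<open>w\<close> positive everywhere. As \<open>w\<close> depends on the second coordinate
    alone, it is invariant under \<Phi> at every point.\<close>
  define w :: "'a \<times> 't \<Rightarrow> real" where
    "w p = (if 0 < z (snd p) \<and> z (snd p) < \<infinity> then sqrt (enn2real (z (snd p))) else 1)" for p
  have [measurable]: "w \<in> borel_measurable R"
    unfolding w_def by measurable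
  have w: "AE p in R. H p = ennreal ((w p)\<^sup>2)"
    using H z_bounds[OF v] by eventually_elim (simp add: w_def)
  interpret invariant_weight R \<Phi> w
  proof
    show "0 < w p" for p by (auto simp: w_def enn2real_positive_iff)
    show "w (\<Phi> p) = w p" for p
      by (cases p) (simp add: w_def PhiMap_def)
    fix g :: "'a \<times> 't \<Rightarrow> ennreal" assume [measurable]: "g \<in> borel_measurable R"
    have "(\<integral>\<^sup>+p. g (\<Phi> p) \<partial>R) = (\<integral>\<^sup>+p. H p * g p \<partial>R)"
      by (rule R.nn_integral_nonsingular[OF ns]) measurable
    also have "\<dots> = (\<integral>\<^sup>+p. ennreal ((w p)\<^sup>2) * g p \<partial>R)"
      by (rule nn_integral_cong_AE) (use w in eventually_elim, simp)
    finally show "(\<integral>\<^sup>+p. g (\<Phi> p) \<partial>R) = (\<integral>\<^sup>+p. ennreal ((w p)\<^sup>2) * g p \<partial>R)" .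
  qed (use ns in measurable)
  show ?thesis by (rule quasinormal_comp_op)
qed

text \<open>Quasinormality makes \<open>H\<close> positive, and this passes down to h; conversely
  (i) leads to (v), where the polar decomposition is explicit.\<close>

lemma cond_iii_iff_i: "cond_iii M N P f z \<longleftrightarrow> cond_i M N P f z"
proof
  assume iii: "cond_iii M N P f z"
  then have ns: "nonsingular R \<Phi>" and qn: "quasinormal R (comp_op R \<Phi>)"
    by (auto simp: cond_iii_def)
  have "AE x in M. 0 < h x"
    by (rule h_pos_of_H_pos[OF ns R.hRN_pos_of_quasinormal[OF ns H_finite[OF ns] qn]])
  with iii show "cond_i M N P f z" by (simp add: cond_i_def cond_iii_def)
next
  assume i: "cond_i M N P f z"
  then have "cond_v M N P f z" by (simp add: cond_i_iff_iv cond_v_iff_iv)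
  with i quasinormal_of_cond_v show "cond_iii M N P f z"
    by (simp add: cond_i_def cond_iii_def cond_v_def)
qed

end

end

theorem theorem7:
  fixes M :: "'a measure" and N :: "'t measure" and P :: "'a \<Rightarrow> 't measure"
    and f :: "'a \<Rightarrow> 'a" and z :: "'t \<Rightarrow> ennreal"
  assumes "sigma_finite_measure M"
    and "f \<in> measurable M M"
    and "prob_family M N P"
    and "z \<in> borel_measurable N"
    and "nonsingular M f"
    and "AE x in M. hRN M f x < \<infinity>"
  shows "(cond_i M N P f z \<longleftrightarrow> cond_ii M N P f z) \<and>
         (cond_i M N P f z \<longleftrightarrow> cond_iii M N P f z) \<and>
         (cond_i M N P f z \<longleftrightarrow> cond_iv M N P f z) \<and>
         (cond_i M N P f z \<longleftrightarrow> cond_v M N P f z) \<and>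
         (cond_i M N P f z \<longleftrightarrow> cond_vi M N P f z) \<and>
         (\<forall>z' \<in> borel_measurable N.
            (cond_i M N P f z \<and> cond_i M N P f z') \<or>
            (cond_ii M N P f z \<and> cond_ii M N P f z') \<or>
            (cond_iii M N P f z \<and> cond_iii M N P f z') \<or>
            (cond_iv M N P f z \<and> cond_iv M N P f z') \<or>
            (cond_v M N P f z \<and> cond_v M N P f z') \<or>
            (cond_vi M N P f z \<and> cond_vi M N P f z')
            \<longrightarrow> (AE p in rho M N P. z (snd p) = z' (snd p))) \<and>
         (cond_i M N P f z \<or> cond_ii M N P f z \<or> cond_iii M N P f z \<or>
          cond_iv M N P f z \<or> cond_v M N P f z \<or> cond_vi M N P f z
            \<longrightarrow> (AE p in rho M N P. 0 < z (snd p) \<and> z (snd p) < \<infinity>))"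
proof -
  interpret sigma_finite_measure M by fact
  interpret family_transformation M N P f
    by unfold_locales (use assms in auto)
  have unique: "AE p in R. z (snd p) = z' (snd p)"
    if "cond_v M N P f z" "cond_v M N P f z'" for z' :: "'t \<Rightarrow> ennreal"
  proof -
    from that have "AE p in R. H p = z (snd p)" "AE p in R. H p = z' (snd p)"
      by (auto simp: cond_v_def)
    then show ?thesis by eventually_elim simp
  qed
  \<comment> \<open>Stated for arbitrary measurable \<open>y\<close>, because uniqueness needs the
    equivalences for both \<open>z\<close> and \<open>z'\<close>.\<close>
  have eqs: "cond_i M N P f y \<longleftrightarrow> cond_v M N P f y" "cond_ii M N P f y \<longleftrightarrow> cond_v M N P f y"
    "cond_iii M N P f y \<longleftrightarrow> cond_v M N P f y" "cond_iv M N P f y \<longleftrightarrow> cond_v M N P f y"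
    "cond_vi M N P f y \<longleftrightarrow> cond_v M N P f y"
    if "y \<in> borel_measurable N" for y
    by (simp_all only: cond_iii_iff_i[OF that] cond_i_iff_iv[OF that] cond_ii_iff_iv[OF that]
        cond_v_iff_iv[OF that] cond_vi_iff_v[OF that])
  show ?thesis
    unfolding eqs[OF assms(4)]
    using eqs unique z_bounds[OF assms(4)] by blast
qed

end
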